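(* Let $K$ be a totally real number field with $\sqrt2\notin K$ admitting a universal classical ternary quadratic form $Q$, and suppose $Q$ is diagonalizable. Then: (1) every element of $2\mathcal{O}_K^+$ is represented by $\langle1,1,2,2\rangle$; (2) either $Q\simeq\langle1,1,\alpha\rangle$ where $2\alpha$ is a sum of two squares of elements of $\mathcal{O}_K$, or $Q\simeq\langle1,\gamma,\alpha\rangle$ where $2=\gamma t^2$ for some $t\in\mathcal{O}_K$ and $2\alpha=x^2+2y^2$ for some $x,y\in\mathcal{O}_K$.
   Context: $\mathcal{O}_K$ is the ring of integers of $K$ and $\mathcal{O}_K^+$ its totally positive elements. A quadratic form $\sum_{i\le j}\alpha_{ij}x_ix_j$ ($\alpha_{ij}\in\mathcal{O}_K$) is classical if $\alpha_{ij}\in2\mathcal{O}_K$ for $i\ne j$, and universal if it is positive definite and represents every element of $\mathcal{O}_K^+$ with integral vectors. $\langle\alpha_1,\dots,\alpha_n\rangle=\alpha_1x_1^2+\dots+\alpha_nx_n^2$; $\simeq$ denotes isometry over $\mathcal{O}_K$; diagonalizable means isometric to some $\langle\alpha_1,\dots,\alpha_n\rangle$. *)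

theory Defs
  imports Complex_Main "HOL-Computational_Algebra.Polynomial" "Jordan_Normal_Form.Matrix"
begin

text \<open>
  The field \<open>K\<close> is the type \<open>'k\<close>; elements, vectors and matrices over its ring of integers are
  those over \<open>'k\<close> whose entries are algebraic integers.
\<close>

definition number_field :: "'k::field_char_0 itself \<Rightarrow> bool" where
  "number_field _ \<longleftrightarrow>
     (\<exists>B::'k set. finite_dimensional_vector_space (\<lambda>(q::rat) x. of_rat q * x) B)"

definition embeddings :: "('k::field_char_0 \<Rightarrow> complex) set" where
  "embeddings = {\<sigma>. field_hom \<sigma>}"

definition totally_real_number_field :: "'k::field_char_0 itself \<Rightarrow> bool" where
  "totally_real_number_field T \<longleftrightarrow>
     number_field T \<and> (\<forall>\<sigma>::'k \<Rightarrow> complex. \<sigma> \<in> embeddings \<longrightarrow> range \<sigma> \<subseteq> \<real>)"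

definition ring_of_integers :: "'k::field_char_0 set" (\<open>\<O>\<^sub>K\<close>) where
  "\<O>\<^sub>K = {x. algebraic_int x}"

definition totally_positive :: "'k::field_char_0 \<Rightarrow> bool" where
  "totally_positive x \<longleftrightarrow> (\<forall>\<sigma>\<in>embeddings. \<sigma> x \<in> \<real> \<and> Re (\<sigma> x) > 0)"

definition totally_positive_integers :: "'k::field_char_0 set" (\<open>\<O>\<^sub>K\<^sup>+\<close>) where
  "\<O>\<^sub>K\<^sup>+ = {x \<in> \<O>\<^sub>K. totally_positive x}"

definition integral_vecs :: "nat \<Rightarrow> 'k::field_char_0 vec set" where
  "integral_vecs n = {x \<in> carrier_vec n. set\<^sub>v x \<subseteq> \<O>\<^sub>K}"

definition integral_mats :: "nat \<Rightarrow> 'k::field_char_0 mat set" where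
  "integral_mats n = {A \<in> carrier_mat n n. elements_mat A \<subseteq> \<O>\<^sub>K}"

definition integral_GL :: "nat \<Rightarrow> 'k::field_char_0 mat set" where
  "integral_GL n =
     {U \<in> integral_mats n. \<exists>V \<in> integral_mats n. inverts_mat U V \<and> inverts_mat V U}"

text \<open>
  The form \<open>\<Sum>i\<le>j. a\<^sub>i\<^sub>j x\<^sub>i x\<^sub>j\<close> is given by the upper triangular matrix of its coefficients
  \<open>a\<^sub>i\<^sub>j\<close>. This is not its Gram matrix: the off-diagonal coefficients are not halved.
\<close>

definition quadratic_forms :: "nat \<Rightarrow> 'k::field_char_0 mat set" where
  "quadratic_forms n = {Q \<in> integral_mats n. upper_triangular Q}"

definition form_value :: "'k::field_char_0 mat \<Rightarrow> 'k vec \<Rightarrow> 'k" where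
  "form_value Q x = (\<Sum>i<dim_row Q. \<Sum>j\<in>{i..<dim_row Q}. Q $$ (i, j) * x $ i * x $ j)"

definition classical_form :: "'k::field_char_0 mat \<Rightarrow> bool" where
  "classical_form Q \<longleftrightarrow> (\<forall>i j. i < j \<and> j < dim_row Q \<longrightarrow> (\<exists>b\<in>\<O>\<^sub>K. Q $$ (i, j) = 2 * b))"

definition represents :: "'k::field_char_0 mat \<Rightarrow> 'k \<Rightarrow> bool" where
  "represents Q a \<longleftrightarrow> (\<exists>x \<in> integral_vecs (dim_row Q). form_value Q x = a)"

definition positive_definite_form :: "'k::field_char_0 mat \<Rightarrow> bool" where
  "positive_definite_form Q \<longleftrightarrow>
     (\<forall>x \<in> integral_vecs (dim_row Q). x \<noteq> 0\<^sub>v (dim_row Q) \<longrightarrow> totally_positive (form_value Q x))"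

definition universal_form :: "'k::field_char_0 mat \<Rightarrow> bool" where
  "universal_form Q \<longleftrightarrow> positive_definite_form Q \<and> (\<forall>a \<in> \<O>\<^sub>K\<^sup>+. represents Q a)"

definition isometric :: "'k::field_char_0 mat \<Rightarrow> 'k mat \<Rightarrow> bool" (infix \<open>\<simeq>\<^sub>K\<close> 50) where
  "Q \<simeq>\<^sub>K R \<longleftrightarrow> dim_row Q = dim_row R \<and>
     (\<exists>U \<in> integral_GL (dim_row Q). \<forall>x \<in> integral_vecs (dim_row Q).
        form_value R x = form_value Q (U *\<^sub>v x))"

definition diag_form :: "'k::field_char_0 list \<Rightarrow> 'k mat" where
  "diag_form as = mat_diag (length as) (\<lambda>i. as ! i)"

definition diagonalizable_form :: "'k::field_char_0 mat \<Rightarrow> bool" where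
  "diagonalizable_form Q \<longleftrightarrow> (\<exists>as. set as \<subseteq> \<O>\<^sub>K \<and> Q \<simeq>\<^sub>K diag_form as)"

end

theory Submission
  imports Defs "Jordan_Normal_Form.Char_Poly" "HOL-Computational_Algebra.Fundamental_Theorem_Algebra"
begin

text \<open>
  An algebraic integer of a number field all of whose conjugates lie in \<open>[0, 1]\<close> is 0 or 1, since
  the product of its conjugates is an integer. Hence 1 is not a sum of two nonzero totally
  nonnegative integers, and 2 is such a sum only as \<open>1 + 1\<close> (apply the first fact to the product of
  the summands). Representing 1 by a diagonal form makes one coefficient a unit square, so \<open>Q\<close> is
  isometric to some \<open>\<langle>1, b, c\<rangle>\<close>; as 2 is not a square, representing 2 leaves \<open>\<langle>1, 1, \<alpha>\<rangle>\<close>, or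
  \<open>\<langle>1, \<gamma>, \<alpha>\<rangle>\<close> with \<open>2 = \<gamma> t\<^sup>2\<close>. In a representation of \<open>2 \<alpha>\<close>, respectively \<open>\<gamma> \<alpha>\<close> (times \<open>t\<^sup>2\<close>),
  the square \<open>s\<close> multiplying \<open>\<alpha>\<close> satisfies \<open>0 \<le> s \<le> 2\<close> in every embedding, hence is 0 or 1.
\<close>

section \<open>Algebraic integers form a ring\<close>

text \<open>A commutative ring is viewed as a module over the integers, so \<open>int_span S\<close>
  is the additive group generated by \<open>S\<close>.\<close>

global_interpretation int_span: Modules.module "\<lambda>(k::int) (x::'a::comm_ring_1). of_int k * x"
  defines int_span = int_span.span
  by unfold_locales (auto simp: algebra_simps)

text \<open>Determinant trick: the generators in \<open>S\<close> form an eigenvector, with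
  eigenvalue \<open>z\<close>, of a matrix with entries from the coefficient ring, and its
  characteristic polynomial is monic. The coefficients enter through \<open>h\<close> so that one
  argument yields both integrality over the integers and algebraicity over the rationals.\<close>

lemma monic_annihilator_if_stable_span:
  fixes z :: "'c::field"
  assumes h: "comm_ring_hom (h :: 'd::comm_ring_1 \<Rightarrow> 'c)"
    and "finite S" and "s \<in> S" and "s \<noteq> 0"
    and stable: "\<And>t. t \<in> S \<Longrightarrow> \<exists>u. z * t = (\<Sum>x\<in>S. h (u x) * x)"
  shows "\<exists>p. lead_coeff p = 1 \<and> poly (map_poly h p) z = 0"
proof -
  interpret h: comm_ring_hom h by (rule h)
  obtain v where v: "bij_betw v {..<card S} S"
    using \<open>finite S\<close> ex_bij_betw_nat_finite[of S] by (auto simp: atLeast0LessThan)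
  define n where "n = card S"
  obtain u where u: "\<And>t. t \<in> S \<Longrightarrow> z * t = (\<Sum>x\<in>S. h (u t x) * x)"
    using stable by metis
  define A where "A = mat n n (\<lambda>(i, j). u (v i) (v j))"
  have A: "A \<in> carrier_mat n n"
    by (simp add: A_def)
  have "eigenvector (map_mat h A) (vec n v) z"
    unfolding eigenvector_def
  proof (intro conjI)
    obtain i where "i < n" "v i = s"
      using v \<open>s \<in> S\<close> unfolding bij_betw_def n_def by (metis imageE lessThan_iff)
    then show "vec n v \<noteq> 0\<^sub>v (dim_row (map_mat h A))"
      using \<open>s \<noteq> 0\<close> A by (metis carrier_matD(1) index_map_mat(2) index_vec index_zero_vec(1))
    show "map_mat h A *\<^sub>v vec n v = z \<cdot>\<^sub>v vec n v"
    proof (rule eq_vecI)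
      fix i assume "i < dim_vec (z \<cdot>\<^sub>v vec n v)"
      then have i: "i < n" by simp
      then have "v i \<in> S" using v unfolding n_def bij_betw_def by blast
      have "z * v i = (\<Sum>x\<in>S. h (u (v i) x) * x)" using u \<open>v i \<in> S\<close> by blast
      also have "\<dots> = (\<Sum>j<n. h (u (v i) (v j)) * v j)"
        unfolding n_def by (rule sum.reindex_bij_betw[OF v, symmetric])
      finally show "(map_mat h A *\<^sub>v vec n v) $ i = (z \<cdot>\<^sub>v vec n v) $ i"
        using i by (simp add: A_def scalar_prod_def atLeast0LessThan)
    qed (use A in simp)
  qed (use A in simp)
  then have "poly (char_poly (map_mat h A)) z = 0"
    using eigenvalue_root_char_poly[of "map_mat h A" n z] A
    by (auto simp: eigenvalue_def)
  then have "poly (map_poly h (char_poly A)) z = 0"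
    by (simp add: h.char_poly_hom[OF A])
  then show ?thesis
    using degree_monic_char_poly[OF A] by auto
qed

lemma algebraic_int_if_int_span_stable:
  fixes z :: "'a::field_char_0"
  assumes "finite S" and "s \<in> S" and "s \<noteq> 0"
    and stable: "\<And>t. t \<in> S \<Longrightarrow> z * t \<in> int_span S"
  shows "algebraic_int z"
proof -
  have "\<exists>u. z * t = (\<Sum>x\<in>S. of_int (u x) * x)" if "t \<in> S" for t
    using stable[OF that] int_span.span_finite[OF \<open>finite S\<close>] by auto
  from monic_annihilator_if_stable_span[OF of_int_hom.comm_ring_hom_axioms assms(1-3) this]
  show ?thesis by (auto simp: algebraic_int_altdef_ipoly)
qed

text \<open>The monic equation of \<open>x\<close> is solved for its leading power. Its degree is
  positive because the constant polynomial 1 has no root; this puts 1 among the powers used.\<close>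

lemma algebraic_int_power_relation:
  fixes x :: "'a::field_char_0"
  assumes "algebraic_int x"
  obtains n where "n > 0" and "x ^ n \<in> int_span ((\<lambda>i. x ^ i) ` {..<n})"
proof -
  obtain p :: "int poly" where p: "poly (map_poly of_int p) x = 0" "lead_coeff p = 1"
    using assms by (auto simp: algebraic_int_altdef_ipoly)
  let ?n = "degree p"
  have "?n > 0"
  proof (rule ccontr)
    assume "\<not> ?n > 0"
    then have "p = [:1:]" using p(2) by (metis degree_eq_zeroE gr0I lead_coeff_pCons(2) pCons_0_0
      coeff_pCons_0 degree_pCons_0)
    then show False using p(1) by simp
  qed
  have "0 = (\<Sum>i\<le>?n. of_int (coeff p i) * x ^ i)"
    using p(1) by (simp add: poly_altdef degree_map_poly coeff_map_poly)
  also have "\<dots> = (\<Sum>i<?n. of_int (coeff p i) * x ^ i) + x ^ ?n"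
    using p(2) by (simp add: lessThan_Suc_atMost[symmetric])
  finally have "x ^ ?n = - (\<Sum>i<?n. of_int (coeff p i) * x ^ i)"
    by (simp add: eq_neg_iff_add_eq_0 add.commute)
  moreover have "(\<Sum>i<?n. of_int (coeff p i) * x ^ i) \<in> int_span ((\<lambda>i. x ^ i) ` {..<?n})"
    by (intro int_span.span_sum int_span.span_scale int_span.span_base) auto
  ultimately show ?thesis
    using \<open>?n > 0\<close> that int_span.span_neg by metis
qed

lemma int_span_mult_stable:
  fixes z :: "'a::comm_ring_1"
  assumes "\<And>t. t \<in> S \<Longrightarrow> z * t \<in> int_span T" and "w \<in> int_span S"
  shows "z * w \<in> int_span T"
  using assms(2)
proof (induction rule: int_span.span_induct_alt)
  case base
  then show ?case by (simp add: int_span.span_zero)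
next
  case (step k x y)
  have "z * (of_int k * x + y) = of_int k * (z * x) + z * y"
    by (simp add: algebra_simps)
  then show ?case
    using assms(1)[OF step.hyps(1)] step.IH
    by (metis int_span.span_add int_span.span_scale)
qed

text \<open>\<open>S\<close> consists of the products \<open>x ^ i * y ^ j\<close> with exponents
  below those of the two power relations. Multiplication by \<open>x\<close> or \<open>y\<close>
  raises one exponent, and once it reaches its bound the power relation brings it back. The sum and
  the product of \<open>x\<close> and \<open>y\<close> then preserve the same group.\<close>

lemma algebraic_int_common_stable_set:
  fixes x y :: "'a::field_char_0"
  assumes "algebraic_int x" and "algebraic_int y"
  obtains S where "finite S" and "1 \<in> S"
    and "\<And>t. t \<in> int_span S \<Longrightarrow> x * t \<in> int_span S"
    and "\<And>t. t \<in> int_span S \<Longrightarrow> y * t \<in> int_span S"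
proof -
  obtain m where m: "m > 0" "x ^ m \<in> int_span ((\<lambda>i. x ^ i) ` {..<m})"
    using algebraic_int_power_relation assms(1) .
  obtain n where n: "n > 0" "y ^ n \<in> int_span ((\<lambda>i. y ^ i) ` {..<n})"
    using algebraic_int_power_relation assms(2) .
  define S where "S = (\<lambda>(i, j). x ^ i * y ^ j) ` ({..<m} \<times> {..<n})"
  have S: "x ^ i * y ^ j \<in> int_span S" if "i < m" "j < n" for i j
    using that by (auto simp: S_def intro!: int_span.span_base)
  have x: "x * t \<in> int_span S" if t: "t \<in> S" for t
  proof -
    obtain i j where ij: "i < m" "j < n" "t = x ^ i * y ^ j"
      using t by (auto simp: S_def)
    show ?thesis
    proof (cases "Suc i < m")
      case True
      then show ?thesis using S[of "Suc i" j] ij by (simp add: mult.assoc)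
    next
      case False
      then have "x * t = y ^ j * x ^ m"
        using ij by (metis less_SucE mult.assoc mult.commute not_less_eq power_Suc)
      moreover have "y ^ j * x ^ m \<in> int_span S"
        by (rule int_span_mult_stable[OF _ m(2)]) (use S ij in \<open>auto simp: mult.commute\<close>)
      ultimately show ?thesis by simp
    qed
  qed
  have y: "y * t \<in> int_span S" if t: "t \<in> S" for t
  proof -
    obtain i j where ij: "i < m" "j < n" "t = x ^ i * y ^ j"
      using t by (auto simp: S_def)
    show ?thesis
    proof (cases "Suc j < n")
      case True
      then show ?thesis using S[of i "Suc j"] ij by (simp add: ac_simps)
    next
      case False
      then have "Suc j = n" using ij by simp
      then have "y * t = x ^ i * y ^ n"
        using ij by (auto simp: ac_simps)
      moreover have "x ^ i * y ^ n \<in> int_span S"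
        by (rule int_span_mult_stable[OF _ n(2)]) (use S ij in auto)
      ultimately show ?thesis by simp
    qed
  qed
  show ?thesis
  proof
    show "finite S" by (simp add: S_def)
    have "(\<lambda>(i, j). x ^ i * y ^ j) (0, 0) \<in> S"
      unfolding S_def by (rule imageI) (use m n in auto)
    then show "1 \<in> S" by simp
  qed (use int_span_mult_stable x y in blast)+
qed

lemma algebraic_int_add [intro]:
  fixes x y :: "'a::field_char_0"
  assumes "algebraic_int x" and "algebraic_int y"
  shows "algebraic_int (x + y)"
proof -
  obtain S where "finite S" "1 \<in> S"
    and S: "\<And>t. t \<in> int_span S \<Longrightarrow> x * t \<in> int_span S" "\<And>t. t \<in> int_span S \<Longrightarrow> y * t \<in> int_span S"
    using algebraic_int_common_stable_set assms by blast
  show ?thesis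
    by (rule algebraic_int_if_int_span_stable[OF \<open>finite S\<close> \<open>1 \<in> S\<close>])
      (auto simp: distrib_right intro!: int_span.span_add S intro: int_span.span_base)
qed

lemma algebraic_int_mult [intro]:
  fixes x y :: "'a::field_char_0"
  assumes "algebraic_int x" and "algebraic_int y"
  shows "algebraic_int (x * y)"
proof -
  obtain S where "finite S" "1 \<in> S"
    and S: "\<And>t. t \<in> int_span S \<Longrightarrow> x * t \<in> int_span S" "\<And>t. t \<in> int_span S \<Longrightarrow> y * t \<in> int_span S"
    using algebraic_int_common_stable_set assms by blast
  show ?thesis
    by (rule algebraic_int_if_int_span_stable[OF \<open>finite S\<close> \<open>1 \<in> S\<close>])
      (auto simp: mult.assoc intro!: S intro: int_span.span_base)
qed

lemma algebraic_int_diff [intro]: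
  fixes x y :: "'a::field_char_0"
  assumes "algebraic_int x" and "algebraic_int y"
  shows "algebraic_int (x - y)"
  using algebraic_int_add[OF assms(1) algebraic_int_minus[OF assms(2)]] by simp

lemma algebraic_int_power [intro]:
  fixes x :: "'a::field_char_0"
  shows "algebraic_int x \<Longrightarrow> algebraic_int (x ^ n)"
  by (induction n) auto

lemma algebraic_int_sum [intro]:
  fixes f :: "'b \<Rightarrow> 'a::field_char_0"
  shows "(\<And>x. x \<in> A \<Longrightarrow> algebraic_int (f x)) \<Longrightarrow> algebraic_int (sum f A)"
  by (induction A rule: infinite_finite_induct) auto

lemma algebraic_int_prod_mset [intro]:
  fixes M :: "'a::field_char_0 multiset"
  shows "(\<And>x. x \<in># M \<Longrightarrow> algebraic_int x) \<Longrightarrow> algebraic_int (prod_mset M)"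
  by (induction M) auto

section \<open>Embeddings of a number field with prescribed value\<close>

text \<open>
  An embedding is obtained as a common eigenvector of the operators \<open>f \<mapsto> f (a * _)\<close> on the
  rational-linear maps from the field to the complex numbers, normalised to take the value 1 at 1.
\<close>

interpretation of_rat_poly_hom: map_poly_comm_ring_hom of_rat ..

definition rat_linear :: "('k::field_char_0 \<Rightarrow> complex) \<Rightarrow> bool" where
  "rat_linear f \<longleftrightarrow> (\<forall>x y. f (x + y) = f x + f y) \<and> (\<forall>q x. f (of_rat q * x) = of_rat q * f x)"

lemma rat_linear_add: "rat_linear f \<Longrightarrow> f (x + y) = f x + f y"
  and rat_linear_scale: "rat_linear f \<Longrightarrow> f (of_rat q * x) = of_rat q * f x"
  by (auto simp: rat_linear_def)

lemma rat_linear_0: "rat_linear f \<Longrightarrow> f 0 = 0"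
  using rat_linear_scale[of f 0] by simp

lemma rat_linear_sum:
  assumes "rat_linear f"
  shows "f (sum g A) = (\<Sum>x\<in>A. f (g x))"
  by (induction A rule: infinite_finite_induct)
    (simp_all add: rat_linear_0[OF assms] rat_linear_add[OF assms])

section \<open>Polynomials in the multiplication operators and their eigenfunctions\<close>

definition eigenfunction :: "'k::field_char_0 \<Rightarrow> complex \<Rightarrow> ('k \<Rightarrow> complex) \<Rightarrow> bool" where
  "eigenfunction a r f \<longleftrightarrow> (\<forall>b. f (a * b) = r * f b)"

text \<open>This is the polynomial \<open>p\<close> evaluated at the operator T that sends
  \<open>f\<close> to \<open>f (a * _)\<close>, applied to \<open>f\<close>.\<close>

definition poly_action :: "'k::field_char_0 \<Rightarrow> complex poly \<Rightarrow> ('k \<Rightarrow> complex) \<Rightarrow> 'k \<Rightarrow> complex" where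
  "poly_action a p f b = (\<Sum>i\<le>degree p. coeff p i * f (a ^ i * b))"

text \<open>Evaluation at the operator T is multiplicative, and the factor \<open>[:-r, 1:]\<close>
  acts as T - r. The case \<open>q = 0\<close> is separate because only for nonzero \<open>q\<close>
  does the factor raise the degree by one.\<close>

lemma poly_action_linear_factor:
  "poly_action a ([:-r, 1:] * q) f b = poly_action a q f (a * b) - r * poly_action a q f b"
proof (cases "q = 0")
  case True
  then show ?thesis by (simp add: poly_action_def)
next
  case False
  let ?n = "degree q"
  have deg: "degree ([:-r, 1:] * q) = Suc ?n"
    using False by (subst degree_mult_eq) auto
  have coeff: "coeff ([:-r, 1:] * q) i = coeff (pCons 0 q) i - r * coeff q i" for i
    by simp
  have "poly_action a ([:-r, 1:] * q) f b =
      (\<Sum>i\<le>Suc ?n. coeff (pCons 0 q) i * f (a ^ i * b)) - (\<Sum>i\<le>Suc ?n. r * coeff q i * f (a ^ i * b))"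
    unfolding poly_action_def deg coeff by (simp only: left_diff_distrib sum_subtractf)
  also have "(\<Sum>i\<le>Suc ?n. coeff (pCons 0 q) i * f (a ^ i * b)) = poly_action a q f (a * b)"
    unfolding poly_action_def by (subst sum.atMost_Suc_shift) (simp add: ac_simps)
  also have "(\<Sum>i\<le>Suc ?n. r * coeff q i * f (a ^ i * b)) = r * poly_action a q f b"
    by (simp add: poly_action_def sum_distrib_left mult.assoc coeff_eq_0)
  finally show ?thesis .
qed

lemma rat_linear_poly_action: "rat_linear f \<Longrightarrow> rat_linear (poly_action a p f)"
  unfolding rat_linear_def poly_action_def
  by (auto simp: distrib_left sum.distrib sum_distrib_left mult.left_commute[of _ "of_rat _"])

text \<open>The operators of \<open>s\<close> and \<open>a\<close> commute because the field does,
  so a polynomial in one preserves the eigenspaces of the other.\<close>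

lemma eigenfunction_poly_action:
  assumes "eigenfunction s r f"
  shows "eigenfunction s r (poly_action a p f)"
  using assms unfolding eigenfunction_def poly_action_def
  by (simp add: sum_distrib_left mult.left_commute[of _ s] mult.left_commute[of _ r])

text \<open>Since the coefficients are rational, linearity moves the whole polynomial inside
  \<open>f\<close>, where it becomes the value of the polynomial at \<open>a\<close>.\<close>

lemma poly_action_annihilator:
  assumes "rat_linear f" and "poly (map_poly of_rat p) a = 0"
  shows "poly_action a (map_poly of_rat p) f b = 0"
proof -
  have "poly_action a (map_poly of_rat p) f b = f (\<Sum>i\<le>degree p. of_rat (coeff p i) * (a ^ i * b))"
    by (simp add: poly_action_def rat_linear_sum[OF assms(1)] rat_linear_scale[OF assms(1)])
  also have "(\<Sum>i\<le>degree p. of_rat (coeff p i) * (a ^ i * b)) = poly (map_poly of_rat p) a * b"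
    by (simp add: poly_altdef sum_distrib_right mult.assoc)
  finally show ?thesis
    using assms by (simp add: rat_linear_0)
qed

text \<open>Linear factors are split off \<open>P\<close> one at a time. As long as the quotient
  \<open>q\<close> still kills \<open>f\<close>, the induction continues with \<open>q\<close>;
  otherwise \<open>q\<close> applied to \<open>f\<close> is nonzero and killed by the removed
  factor, hence an eigenfunction. A nonzero constant cannot kill \<open>f\<close>, so this must
  happen.\<close>

lemma eigenfunction_exists:
  assumes "f \<noteq> (\<lambda>_. 0)" and "P \<noteq> 0" and "poly_action a P f = (\<lambda>_. 0)"
  shows "\<exists>q r. poly_action a q f \<noteq> (\<lambda>_. 0) \<and> eigenfunction a r (poly_action a q f)"
  using assms(2,3)
proof (induction "degree P" arbitrary: P)
  case 0
  then obtain k where "P = [:k:]" "k \<noteq> 0"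
    by (metis degree_eq_zeroE pCons_0_0)
  then have "k * f b = 0" for b
    using fun_cong[OF 0(3), of b] by (simp add: poly_action_def)
  then show ?case using \<open>k \<noteq> 0\<close> assms(1) by auto
next
  case (Suc n)
  obtain r where "poly P r = 0"
    using fundamental_theorem_of_algebra_alt[of P] Suc(2)
    by (metis degree_pCons_0 nat.distinct(1))
  then obtain q where P: "P = [:-r, 1:] * q"
    by (auto simp: poly_eq_0_iff_dvd)
  then have q: "q \<noteq> 0" "degree q = n"
    using Suc(2,3) by (auto simp: degree_mult_eq simp del: mult_pCons_left)
  show ?case
  proof (cases "poly_action a q f = (\<lambda>_. 0)")
    case True
    then show ?thesis using Suc(1) q by blast
  next
    case False
    have "eigenfunction a r (poly_action a q f)"
      using fun_cong[OF Suc(4)] unfolding P poly_action_linear_factor eigenfunction_def by simp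
    then show ?thesis using False by blast
  qed
qed

text \<open>The elements of \<open>S\<close> are treated in turn. Each replaces the function by a
  polynomial in its own operator applied to it, which keeps all earlier eigenvalues by commutation.
  The last conjunct lets an eigenvalue prescribed for \<open>f\<close> survive the process.\<close>

lemma common_eigenfunction:
  fixes f :: "'k::field_char_0 \<Rightarrow> complex"
  assumes "finite S" and "rat_linear f" and "f \<noteq> (\<lambda>_. 0)"
    and alg: "\<And>s. s \<in> S \<Longrightarrow> \<exists>p. p \<noteq> 0 \<and> poly (map_poly of_rat p) s = 0"
  shows "\<exists>g. rat_linear g \<and> g \<noteq> (\<lambda>_. 0) \<and> (\<forall>s\<in>S. \<exists>r. eigenfunction s r g) \<and>
    (\<forall>c r. eigenfunction c r f \<longrightarrow> eigenfunction c r g)"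
  using assms(1) alg
proof (induction S rule: finite_induct)
  case empty
  then show ?case using assms(2,3) by auto
next
  case (insert a S)
  then obtain g where g: "rat_linear g" "g \<noteq> (\<lambda>_. 0)" "\<forall>s\<in>S. \<exists>r. eigenfunction s r g"
    "\<forall>c r. eigenfunction c r f \<longrightarrow> eigenfunction c r g"
    by auto
  obtain p :: "rat poly" where p: "p \<noteq> 0" "poly (map_poly of_rat p) a = 0"
    using insert.prems[of a] by auto
  have "(map_poly of_rat p :: complex poly) \<noteq> 0"
    using p(1) by simp
  moreover have "poly_action a (map_poly of_rat p) g = (\<lambda>_. 0)"
    using poly_action_annihilator[OF g(1) p(2)] by auto
  ultimately obtain q r where "poly_action a q g \<noteq> (\<lambda>_. 0)" "eigenfunction a r (poly_action a q g)"
    using eigenfunction_exists[OF g(2)] by blast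
  then show ?case
    using g rat_linear_poly_action[OF g(1), of a q] eigenfunction_poly_action[of _ _ g a q]
    by (intro exI[of _ "poly_action a q g"]) blast
qed

text \<open>An annihilator of least degree divides every other one, since the remainder of the
  division is again an annihilator; dividing by its leading coefficient makes it monic.\<close>

lemma minimal_polynomial_exists:
  fixes c :: "'k::field_char_0"
  assumes "p\<^sub>0 \<noteq> 0" and "poly (map_poly of_rat p\<^sub>0) c = 0"
  obtains p where "lead_coeff p = 1" and "poly (map_poly of_rat p) c = 0"
    and "\<And>q. poly (map_poly of_rat q) c = 0 \<Longrightarrow> p dvd q"
proof -
  obtain p where p: "p \<noteq> 0" "poly (map_poly of_rat p) c = 0"
    and least: "\<And>q. q \<noteq> 0 \<Longrightarrow> poly (map_poly of_rat q) c = 0 \<Longrightarrow> degree p \<le> degree q"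
    using ex_has_least_nat[of "\<lambda>p. p \<noteq> 0 \<and> poly (map_poly of_rat p) c = 0" p\<^sub>0 degree] assms by blast
  have dvd: "p dvd q" if q: "poly (map_poly of_rat q) c = 0" for q
  proof -
    have "map_poly of_rat q = map_poly of_rat (q div p) * map_poly of_rat p +
        (map_poly of_rat (q mod p) :: 'k poly)"
      by (simp flip: of_rat_poly_hom.hom_mult of_rat_poly_hom.hom_add)
    then have "poly (map_poly of_rat (q mod p)) c = 0"
      using p q by (metis add_0 mult_zero_right poly_add poly_mult)
    then have "q mod p = 0"
      using least[of "q mod p"] degree_mod_less'[of p q] p(1) by fastforce
    then show ?thesis by auto
  qed
  show ?thesis
  proof
    show "lead_coeff (Polynomial.smult (inverse (lead_coeff p)) p) = 1"
      using p(1) by simp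
    show "poly (map_poly of_rat (Polynomial.smult (inverse (lead_coeff p)) p)) c = 0"
      using p(2) by (simp add: of_rat_hom.map_poly_hom_smult)
    show "Polynomial.smult (inverse (lead_coeff p)) p dvd q" if "poly (map_poly of_rat q) c = 0" for q
      using dvd[OF that] p(1) by (simp add: smult_dvd_iff)
  qed
qed

section \<open>Embeddings of a number field\<close>

lemma number_field_basis:
  assumes "number_field TYPE('k::field_char_0)"
  obtains B :: "'k::field_char_0 set" where "finite_dimensional_vector_space (\<lambda>(q::rat) x. of_rat q * x) B"
  using assms by (auto simp: number_field_def)

text \<open>The determinant trick applies to a finite rational basis: its span is the whole field,
  hence stable under multiplication by \<open>a\<close>.\<close>

lemma number_field_algebraic:
  fixes a :: "'k::field_char_0"
  assumes "number_field TYPE('k)"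
  shows "\<exists>p. p \<noteq> 0 \<and> poly (map_poly of_rat p) a = 0"
proof -
  obtain B :: "'k set" where "finite_dimensional_vector_space (\<lambda>(q::rat) x. of_rat q * x) B"
    using number_field_basis assms .
  then interpret V: finite_dimensional_vector_space "\<lambda>(q::rat) x::'k. of_rat q * x" B .
  have "B \<noteq> {}"
    using V.span_Basis V.span_empty by (metis UNIV_I singletonD zero_neq_one)
  then obtain s where s: "s \<in> B" "s \<noteq> 0"
    using V.independent_Basis V.dependent_zero by blast
  have "\<exists>u. a * t = (\<Sum>x\<in>B. of_rat (u x) * x)" for t
    using V.span_finite[OF V.finite_Basis] V.span_Basis by auto
  from monic_annihilator_if_stable_span[OF of_rat_hom.comm_ring_hom_axioms V.finite_Basis s this]
  obtain p where "lead_coeff p = 1" "poly (map_poly of_rat p) a = 0"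
    by blast
  then show ?thesis
    by (intro exI[of _ p]) auto
qed

text \<open>First \<open>f\<close> is replaced by a common eigenfunction \<open>g\<close> for a
  basis. The elements having \<open>g\<close> as eigenfunction form a rational subspace, hence are
  all of the field, and \<open>g\<close> divided by its value at 1 is the embedding.\<close>

lemma embedding_of_eigenfunction:
  fixes f :: "'k::field_char_0 \<Rightarrow> complex"
  assumes K: "number_field TYPE('k)" and "rat_linear f" and "f \<noteq> (\<lambda>_. 0)" and "eigenfunction c r f"
  obtains \<sigma> where "\<sigma> \<in> embeddings" and "\<sigma> c = r"
proof -
  obtain B :: "'k set" where "finite_dimensional_vector_space (\<lambda>(q::rat) x. of_rat q * x) B"
    using number_field_basis K .
  then interpret V: finite_dimensional_vector_space "\<lambda>(q::rat) x::'k. of_rat q * x" B .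
  obtain g where g: "rat_linear g" "g \<noteq> (\<lambda>_. 0)" "\<forall>s\<in>B. \<exists>r. eigenfunction s r g"
    and gc: "eigenfunction c r g"
    using common_eigenfunction[OF V.finite_Basis assms(2,3)] number_field_algebraic[OF K] assms(4)
    by blast
  have "V.subspace {a. \<exists>r. eigenfunction a r g}"
  proof (rule V.subspaceI)
    show "0 \<in> {a. \<exists>r. eigenfunction a r g}"
      by (auto simp: eigenfunction_def rat_linear_0[OF g(1)] intro: exI[of _ 0])
  next
    fix x y assume "x \<in> {a. \<exists>r. eigenfunction a r g}" "y \<in> {a. \<exists>r. eigenfunction a r g}"
    then obtain r r' where "eigenfunction x r g" "eigenfunction y r' g" by auto
    then have "eigenfunction (x + y) (r + r') g"
      by (simp add: eigenfunction_def distrib_right rat_linear_add[OF g(1)])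
    then show "x + y \<in> {a. \<exists>r. eigenfunction a r g}" by auto
  next
    fix q x assume "x \<in> {a. \<exists>r. eigenfunction a r g}"
    then obtain r where "eigenfunction x r g" by auto
    then have "eigenfunction (of_rat q * x) (of_rat q * r) g"
      by (simp add: eigenfunction_def mult.assoc rat_linear_scale[OF g(1)])
    then show "of_rat q * x \<in> {a. \<exists>r. eigenfunction a r g}" by auto
  qed
  then have "V.span B \<subseteq> {a. \<exists>r. eigenfunction a r g}"
    using g(3) by (intro V.span_minimal) auto
  then have "\<exists>r. eigenfunction a r g" for a
    using V.span_Basis by auto
  then obtain l where l: "\<And>a b. g (a * b) = l a * g b"
    unfolding eigenfunction_def by metis
  have g1: "g 1 \<noteq> 0"
  proof
    assume "g 1 = 0"
    then have "g a = 0" for a using l[of a 1] by simp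
    then show False using g(2) by auto
  qed
  define \<sigma> where "\<sigma> a = g a / g 1" for a
  \<comment> \<open>The normalised \<open>g\<close> equals the eigenvalue map \<open>l\<close>:
    additivity is inherited from \<open>g\<close>, multiplicativity from the eigenvalue
    equation.\<close>
  have \<sigma>: "\<sigma> = l"
  proof
    show "\<sigma> a = l a" for a using l[of a 1] g1 by (simp add: \<sigma>_def)
  qed
  have "field_hom \<sigma>"
  proof
    show "\<sigma> (x + y) = \<sigma> x + \<sigma> y" for x y
      by (simp add: \<sigma>_def rat_linear_add[OF g(1)] add_divide_distrib)
    show "\<sigma> (x * y) = \<sigma> x * \<sigma> y" for x y
      using l[of x y] by (simp add: \<sigma>[symmetric]) (simp add: \<sigma>_def)
    show "\<sigma> 0 = 0" "\<sigma> 1 = 1"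
      using g1 by (simp_all add: \<sigma>_def rat_linear_0[OF g(1)])
  qed
  moreover have "\<sigma> c = r"
    using gc[unfolded eigenfunction_def, rule_format, of 1] g1 by (simp add: \<sigma>_def)
  ultimately show ?thesis
    using that by (auto simp: embeddings_def)
qed

text \<open>Every root \<open>r\<close> of the minimal polynomial is a conjugate of
  \<open>c\<close>. Writing the polynomial as (X - r) q, the action of q on any rational-linear
  \<open>f\<close> gives an eigenfunction for \<open>r\<close>. To make it nonzero, \<open>f\<close>
  is chosen to vanish on \<open>c ^ i\<close> for \<open>i < m\<close> and to be 1 on
  \<open>c ^ m\<close>, where \<open>m\<close> is the degree of the monic q: its value at 1 is then
  1.\<close>

lemma embedding_with_root:
  fixes c :: "'k::field_char_0"
  assumes K: "number_field TYPE('k)"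
    and monic: "lead_coeff p = 1" and root: "poly (map_poly of_rat p) c = 0"
    and min: "\<And>q. poly (map_poly of_rat q) c = 0 \<Longrightarrow> p dvd q"
    and r: "poly (map_poly of_rat p) r = 0"
  obtains \<sigma> where "\<sigma> \<in> embeddings" and "\<sigma> c = r"
proof -
  obtain B :: "'k set" where "finite_dimensional_vector_space (\<lambda>(q::rat) x. of_rat q * x) B"
    using number_field_basis K .
  then interpret V: finite_dimensional_vector_space "\<lambda>(q::rat) x::'k. of_rat q * x" B .
  interpret VC: vector_space_pair "\<lambda>(q::rat) x::'k. of_rat q * x" "\<lambda>(q::rat) x::complex. of_rat q * x"
    by unfold_locales (auto simp: algebra_simps of_rat_add of_rat_mult)
  obtain q where q: "map_poly of_rat p = [:-r, 1:] * q"
    using r by (auto simp: poly_eq_0_iff_dvd)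
  have "p \<noteq> 0" using monic by auto
  then have "q \<noteq> 0" using q by auto
  define m where "m = degree q"
  have deg: "degree p = Suc m"
    using \<open>q \<noteq> 0\<close> arg_cong[OF q, of degree] by (simp add: m_def degree_mult_eq del: mult_pCons_left)
  have lead: "coeff q m = 1"
    using monic arg_cong[OF q, of lead_coeff] unfolding m_def lead_coeff_mult by simp
  \<comment> \<open>These are the polynomials of degree below \<open>m\<close>, described by
    coefficients so that the zero polynomial is included even for \<open>m = 0\<close>.\<close>
  let ?H = "{h :: rat poly. \<forall>i\<ge>m. coeff h i = 0}"
  have "V.span ((\<lambda>i. c ^ i) ` {..<m}) \<subseteq> (\<lambda>h. poly (map_poly of_rat h) c) ` ?H"
  proof (rule V.span_minimal)
    show "(\<lambda>i. c ^ i) ` {..<m} \<subseteq> (\<lambda>h. poly (map_poly of_rat h) c) ` ?H"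
    proof safe
      fix i assume "i < m"
      then have "monom 1 i \<in> ?H" by auto
      moreover have "c ^ i = poly (map_poly of_rat (monom 1 i)) c"
        by (simp add: poly_monom map_poly_monom)
      ultimately show "c ^ i \<in> (\<lambda>h. poly (map_poly of_rat h) c) ` ?H" by blast
    qed
    show "V.subspace ((\<lambda>h. poly (map_poly of_rat h) c) ` ?H)"
    proof (rule V.subspaceI)
      show "0 \<in> (\<lambda>h. poly (map_poly of_rat h) c) ` ?H"
        by (rule image_eqI[of _ _ 0]) auto
    next
      fix x y assume "x \<in> (\<lambda>h. poly (map_poly of_rat h) c) ` ?H" "y \<in> (\<lambda>h. poly (map_poly of_rat h) c) ` ?H"
      then obtain h h' where "h \<in> ?H" "h' \<in> ?H"
        and "x = poly (map_poly of_rat h) c" "y = poly (map_poly of_rat h') c" by auto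
      then show "x + y \<in> (\<lambda>h. poly (map_poly of_rat h) c) ` ?H"
        by (intro image_eqI[of _ _ "h + h'"]) (auto simp: of_rat_hom.map_poly_hom_add)
    next
      fix k x assume "x \<in> (\<lambda>h. poly (map_poly of_rat h) c) ` ?H"
      then obtain h where "h \<in> ?H" "x = poly (map_poly of_rat h) c" by auto
      then show "of_rat k * x \<in> (\<lambda>h. poly (map_poly of_rat h) c) ` ?H"
        by (intro image_eqI[of _ _ "Polynomial.smult k h"]) (auto simp: of_rat_hom.map_poly_hom_smult)
    qed
  qed
  \<comment> \<open>Expressing \<open>c ^ m\<close> by lower powers would give a nonzero annihilator
    of degree \<open>m\<close>, whereas \<open>p\<close> has degree \<open>Suc m\<close> and divides
    every annihilator.\<close>
  moreover have "c ^ m \<notin> (\<lambda>h. poly (map_poly of_rat h) c) ` ?H"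
  proof
    assume "c ^ m \<in> (\<lambda>h. poly (map_poly of_rat h) c) ` ?H"
    then obtain h where h: "h \<in> ?H" "c ^ m = poly (map_poly of_rat h) c" by auto
    let ?d = "monom 1 m - h"
    have "poly (map_poly of_rat ?d) c = 0"
      using h(2) by (simp add: poly_monom map_poly_monom of_rat_poly_hom.hom_minus)
    then have "p dvd ?d" using min by blast
    moreover have d: "coeff ?d m = 1" "\<forall>i>m. coeff ?d i = 0"
      using h(1) by auto
    then have "degree ?d \<le> m" "?d \<noteq> 0"
      by (auto simp: degree_le)
    ultimately show False
      using dvd_imp_degree_le[of p ?d] deg by simp
  qed
  ultimately have cm: "c ^ m \<notin> V.span ((\<lambda>i. c ^ i) ` {..<m})" by blast
  \<comment> \<open>A linear map can be prescribed freely on an independent set, so the lower powers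
    are thinned out to such a set with the same span.\<close>
  obtain C where C: "C \<subseteq> (\<lambda>i. c ^ i) ` {..<m}" "V.independent C"
    "(\<lambda>i. c ^ i) ` {..<m} \<subseteq> V.span C"
    using V.maximal_independent_subset[of "(\<lambda>i. c ^ i) ` {..<m}"] by blast
  have cm': "c ^ m \<notin> V.span C"
    using cm V.span_mono[OF C(1)] by blast
  then have "V.independent (insert (c ^ m) C)"
    using C(2) by (simp add: V.independent_insert V.span_base)
  then obtain f where f: "Vector_Spaces.linear (\<lambda>(q::rat) x::'k. of_rat q * x) (\<lambda>(q::rat) x::complex. of_rat q * x) f"
    and fx: "\<forall>x\<in>insert (c ^ m) C. f x = (if x = c ^ m then 1 else 0)"
    using VC.linear_independent_extend[of _ "\<lambda>x. if x = c ^ m then 1 else 0"] by metis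
  have rl: "rat_linear f"
    using VC.linear_add[OF f] VC.linear_scale[OF f] by (simp add: rat_linear_def)
  have "f x = 0" if "x \<in> C" for x
    using fx that cm' V.span_base by (metis insertCI)
  then have "f x = 0" if "x \<in> V.span C" for x
    using VC.linear_eq_0_on_span[OF f] that by blast
  then have f0: "f (c ^ i) = 0" if "i < m" for i
    using C(3) that by blast
  have "poly_action c q f 1 = (\<Sum>i<m. coeff q i * f (c ^ i)) + coeff q m * f (c ^ m)"
    by (simp add: poly_action_def m_def lessThan_Suc_atMost[symmetric])
  also have "\<dots> = 1"
    using f0 lead fx by simp
  finally have "poly_action c q f \<noteq> (\<lambda>_. 0)" by auto
  \<comment> \<open>Applying T - r to this function gives the action of all of \<open>p\<close>,
    which is zero.\<close>
  moreover have "eigenfunction c r (poly_action c q f)"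
    using poly_action_annihilator[OF rl root] unfolding q poly_action_linear_factor
    by (simp add: eigenfunction_def)
  ultimately show ?thesis
    by (rule embedding_of_eigenfunction[OF K rat_linear_poly_action[OF rl]]) (rule that)
qed

section \<open>Algebraic integers with all conjugates in the unit interval\<close>

lemma prod_mset_norm_less_1:
  fixes M :: "complex multiset"
  assumes "\<And>x. x \<in># M \<Longrightarrow> norm x < 1" and "M \<noteq> {#}"
  shows "norm (prod_mset M) < 1"
  using assms
proof (induction M)
  case (add x M)
  show ?case
  proof (cases "M = {#}")
    case False
    then have "norm (prod_mset M) < 1" "norm x < 1" using add by auto
    then have "norm x * norm (prod_mset M) < 1 * 1"
      by (intro mult_strict_mono) auto
    then show ?thesis by (simp add: norm_mult)
  qed (use add in auto)
qed simp

text \<open>For \<open>c \<noteq> 0\<close> the constant coefficient of the minimal polynomial is a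
  nonzero integer and, up to sign, the product of the roots. Hence some root has modulus at least 1.
  It is the image of \<open>c\<close> under an embedding, so it lies in [0, 1] and equals 1;
  embeddings are injective.\<close>

lemma conjugates_in_unit_interval:
  fixes c :: "'k::field_char_0"
  assumes K: "number_field TYPE('k)" and c: "algebraic_int c"
    and unit: "\<And>\<sigma>. \<sigma> \<in> embeddings \<Longrightarrow> \<sigma> c \<in> \<real> \<and> 0 \<le> Re (\<sigma> c) \<and> Re (\<sigma> c) \<le> 1"
  shows "c = 0 \<or> c = 1"
proof (cases "c = 0")
  case False
  obtain P :: "int poly" where P: "poly (map_poly of_int P) c = 0" "lead_coeff P = 1"
    using c by (auto simp: algebraic_int_altdef_ipoly)
  define P' :: "rat poly" where "P' = map_poly of_int P"
  have "P' \<noteq> 0" using P(2) by (auto simp: P'_def)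
  moreover have root_P': "poly (map_poly of_rat P') c = 0"
    using P(1) by (simp add: P'_def map_poly_map_poly o_def)
  ultimately obtain p :: "rat poly" where p: "lead_coeff p = 1" "poly (map_poly of_rat p) c = 0"
    and min: "\<And>q. poly (map_poly of_rat q) c = 0 \<Longrightarrow> p dvd q"
    using minimal_polynomial_exists by blast
  define pC :: "complex poly" where "pC = map_poly of_rat p"
  have "p \<noteq> 0" using p(1) by auto
  then have pC: "pC \<noteq> 0" by (simp add: pC_def)
  have "degree p \<noteq> 0"
  proof
    assume "degree p = 0"
    then obtain k where "p = [:k:]" by (rule degree_eq_zeroE)
    then show False using p by auto
  qed
  \<comment> \<open>The minimal polynomial divides the monic integer polynomial of \<open>c\<close>,
    so all its roots are integral.\<close>
  have int_roots: "algebraic_int x" if "poly pC x = 0" for x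
  proof -
    obtain h where "P' = p * h" using min[OF root_P'] by (elim dvdE)
    then have "poly (map_poly of_rat P') x = 0"
      using that by (simp add: pC_def of_rat_poly_hom.hom_mult)
    then have "poly (map_poly of_int P) x = 0"
      by (simp add: P'_def map_poly_map_poly o_def)
    then show ?thesis using P(2) by (auto simp: algebraic_int_altdef_ipoly)
  qed
  \<comment> \<open>With the roots negated, the product is the constant coefficient itself, without
    a sign.\<close>
  define M where "M = image_mset uminus (proots pC)"
  have "(\<Prod>x\<in>#proots pC. [:- x, 1:]) = pC"
    using complex_poly_decompose_multiset[of pC] p(1) by (simp add: pC_def)
  then have "poly pC 0 = poly (\<Prod>x\<in>#proots pC. [:- x, 1:]) 0"
    by simp
  also have "\<dots> = prod_mset M"
    by (simp add: M_def poly_prod_mset)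
  finally have M: "of_rat (coeff p 0) = prod_mset M"
    by (simp add: poly_0_coeff_0 pC_def)
  \<comment> \<open>Otherwise a factor X could be cancelled because \<open>c \<noteq> 0\<close>,
    leaving an annihilator of smaller degree.\<close>
  have "coeff p 0 \<noteq> 0"
  proof
    assume "coeff p 0 = 0"
    then obtain h where h: "p = pCons 0 h" by (metis coeff_pCons_0 pCons_cases)
    then have "poly (map_poly of_rat h) c = 0"
      using p(2) False by (simp add: of_rat_hom.map_poly_pCons_hom)
    then have "p dvd h" using min by blast
    moreover have "h \<noteq> 0" using h \<open>p \<noteq> 0\<close> by auto
    ultimately show False
      using dvd_imp_degree_le[of p h] h by simp
  qed
  moreover have "algebraic_int (prod_mset M)"
    using int_roots pC by (intro algebraic_int_prod_mset) (auto simp: M_def)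
  \<comment> \<open>The coefficient is rational and, as a product of algebraic integers, integral;
    hence it is an integer.\<close>
  then have "of_rat (coeff p 0) \<in> (\<int> :: complex set)"
    using rational_algebraic_int_is_int[of "prod_mset M"] unfolding M[symmetric] by simp
  then obtain k where k: "complex_of_rat (coeff p 0) = of_int k"
    by (elim Ints_cases)
  ultimately have "k \<noteq> 0" by auto
  then have "norm (prod_mset M) \<ge> 1"
    unfolding M[symmetric] k norm_of_int by linarith
  moreover have "M \<noteq> {#}"
    using size_proots_complex[of pC] \<open>degree p \<noteq> 0\<close> by (auto simp: M_def pC_def)
  ultimately obtain x where x: "x \<in># proots pC" "norm x \<ge> 1"
    using prod_mset_norm_less_1[of M] by (force simp: M_def)
  then have "poly (map_poly of_rat p) x = 0"
    using pC by (simp add: pC_def)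
  then obtain \<sigma> where \<sigma>: "\<sigma> \<in> embeddings" "\<sigma> c = x"
    using embedding_with_root[OF K p min] by blast
  interpret \<sigma>: field_hom \<sigma>
    using \<sigma>(1) by (simp add: embeddings_def)
  have "x = 1"
    using unit[OF \<sigma>(1)] \<sigma>(2) x(2) by (auto elim!: Reals_cases)
  then show ?thesis
    using \<sigma>(2) by (metis \<sigma>.eq_iff \<sigma>.hom_one)
qed simp

section \<open>Decompositions of 1 and 2 into totally nonnegative integers\<close>

text \<open>The terms of a representation by a positive definite diagonal form may vanish, so total
  positivity alone does not describe them.\<close>

definition totally_nonnegative :: "'k::field_char_0 \<Rightarrow> bool" where
  "totally_nonnegative x \<longleftrightarrow> (\<forall>\<sigma>\<in>embeddings. \<sigma> x \<in> \<real> \<and> Re (\<sigma> x) \<ge> 0)"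

lemma embedding_hom: "\<sigma> \<in> embeddings \<Longrightarrow> field_hom \<sigma>"
  by (simp add: embeddings_def)

lemma totally_nonnegative_if_positive: "totally_positive x \<Longrightarrow> totally_nonnegative x"
  by (auto simp: totally_positive_def totally_nonnegative_def less_imp_le)

lemma totally_nonnegative_add:
  assumes "totally_nonnegative x" and "totally_nonnegative y"
  shows "totally_nonnegative (x + y)"
  unfolding totally_nonnegative_def
proof
  fix \<sigma> :: "'a \<Rightarrow> complex" assume \<sigma>: "\<sigma> \<in> embeddings"
  interpret field_hom \<sigma> using embedding_hom \<sigma> .
  show "\<sigma> (x + y) \<in> \<real> \<and> Re (\<sigma> (x + y)) \<ge> 0"
    using assms \<sigma> by (simp add: totally_nonnegative_def hom_add)
qed

lemma totally_nonnegative_mult: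
  assumes "totally_nonnegative x" and "totally_nonnegative y"
  shows "totally_nonnegative (x * y)"
  unfolding totally_nonnegative_def
proof
  fix \<sigma> :: "'a \<Rightarrow> complex" assume \<sigma>: "\<sigma> \<in> embeddings"
  interpret field_hom \<sigma> using embedding_hom \<sigma> .
  show "\<sigma> (x * y) \<in> \<real> \<and> Re (\<sigma> (x * y)) \<ge> 0"
    using assms \<sigma> by (simp add: totally_nonnegative_def hom_mult complex_is_Real_iff)
qed

lemma totally_positive_mult:
  assumes "totally_positive x" and "totally_positive y"
  shows "totally_positive (x * y)"
  unfolding totally_positive_def
proof
  fix \<sigma> :: "'a \<Rightarrow> complex" assume \<sigma>: "\<sigma> \<in> embeddings"
  interpret field_hom \<sigma> using embedding_hom \<sigma> .
  show "\<sigma> (x * y) \<in> \<real> \<and> Re (\<sigma> (x * y)) > 0"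
    using assms \<sigma> by (simp add: totally_positive_def hom_mult complex_is_Real_iff)
qed

lemma totally_positive_add:
  assumes "totally_positive x" and "totally_positive y"
  shows "totally_positive (x + y)"
  unfolding totally_positive_def
proof
  fix \<sigma> :: "'a \<Rightarrow> complex" assume \<sigma>: "\<sigma> \<in> embeddings"
  interpret field_hom \<sigma> using embedding_hom \<sigma> .
  show "\<sigma> (x + y) \<in> \<real> \<and> Re (\<sigma> (x + y)) > 0"
    using assms \<sigma> by (simp add: totally_positive_def hom_add add_pos_pos)
qed

lemma totally_positive_1: "totally_positive (1 :: 'k::field_char_0)"
  unfolding totally_positive_def
proof
  fix \<sigma> :: "'k \<Rightarrow> complex" assume \<sigma>: "\<sigma> \<in> embeddings"
  interpret field_hom \<sigma> using embedding_hom \<sigma> .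
  show "\<sigma> 1 \<in> \<real> \<and> Re (\<sigma> 1) > 0"
    by simp
qed

lemma totally_positive_2: "totally_positive (2 :: 'k::field_char_0)"
  using totally_positive_add[OF totally_positive_1 totally_positive_1] by simp

text \<open>This later bounds a square: for totally positive \<alpha>, total nonnegativity of
  \<open>\<alpha> * (2 - z\<^sup>2)\<close> passes to \<open>2 - z\<^sup>2\<close>.\<close>

lemma totally_nonnegative_cancel:
  assumes "totally_positive x" and "totally_nonnegative (x * y)"
    and real: "totally_real_number_field TYPE('k::field_char_0)"
  shows "totally_nonnegative (y :: 'k)"
  unfolding totally_nonnegative_def
proof
  fix \<sigma> :: "'k \<Rightarrow> complex" assume \<sigma>: "\<sigma> \<in> embeddings"
  interpret field_hom \<sigma> using embedding_hom \<sigma> .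
  have "\<sigma> x \<in> \<real>" "Re (\<sigma> x) > 0" "Re (\<sigma> (x * y)) \<ge> 0"
    using assms(1,2) \<sigma> by (auto simp: totally_positive_def totally_nonnegative_def)
  moreover have "\<sigma> y \<in> \<real>"
    using real \<sigma> unfolding totally_real_number_field_def by blast
  ultimately show "\<sigma> y \<in> \<real> \<and> Re (\<sigma> y) \<ge> 0"
    by (auto simp: hom_mult complex_is_Real_iff zero_le_mult_iff)
qed

lemma totally_nonnegative_square:
  assumes "totally_real_number_field TYPE('k::field_char_0)"
  shows "totally_nonnegative ((x :: 'k)\<^sup>2)"
  unfolding totally_nonnegative_def
proof
  fix \<sigma> :: "'k \<Rightarrow> complex" assume \<sigma>: "\<sigma> \<in> embeddings"
  interpret field_hom \<sigma> using embedding_hom \<sigma> .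
  have "\<sigma> x \<in> \<real>"
    using assms \<sigma> unfolding totally_real_number_field_def by blast
  then show "\<sigma> (x\<^sup>2) \<in> \<real> \<and> Re (\<sigma> (x\<^sup>2)) \<ge> 0"
    by (simp add: power2_eq_square hom_mult complex_is_Real_iff)
qed

lemma totally_nonnegative_sum_1:
  fixes a b :: "'k::field_char_0"
  assumes K: "number_field TYPE('k)" and "a \<in> \<O>\<^sub>K"
    and nonneg: "totally_nonnegative a" "totally_nonnegative b" and sum: "a + b = 1"
  shows "a = 0 \<or> a = 1"
proof (rule conjugates_in_unit_interval[OF K])
  show "algebraic_int a" using assms(2) by (simp add: ring_of_integers_def)
  fix \<sigma> :: "'k \<Rightarrow> complex" assume \<sigma>: "\<sigma> \<in> embeddings"
  interpret field_hom \<sigma> using embedding_hom \<sigma> .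
  have "\<sigma> a + \<sigma> b = 1" by (metis hom_add hom_one sum)
  then have "Re (\<sigma> a) + Re (\<sigma> b) = 1" by (metis one_complex.sel(1) plus_complex.sel(1))
  then show "\<sigma> a \<in> \<real> \<and> 0 \<le> Re (\<sigma> a) \<and> Re (\<sigma> a) \<le> 1"
    using nonneg \<sigma> by (force simp: totally_nonnegative_def)
qed

text \<open>A conjugate of \<open>a * b\<close> has the form s (2 - s) = 1 - (1 - s)^2 with s and 2
  - s nonnegative, so it lies in [0, 1] and \<open>a * b\<close> is 0 or 1. In the second case
  \<open>(a - 1)\<^sup>2\<close> is zero.\<close>

lemma totally_nonnegative_sum_2:
  fixes a b :: "'k::field_char_0"
  assumes K: "number_field TYPE('k)" and "a \<in> \<O>\<^sub>K"
    and nonneg: "totally_nonnegative a" "totally_nonnegative b" and sum: "a + b = 2"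
  shows "a = 0 \<or> b = 0 \<or> a = 1 \<and> b = 1"
proof -
  have b: "b = 2 - a" using sum by (simp add: eq_diff_eq add.commute)
  have "a * b = 0 \<or> a * b = 1"
  proof (rule conjugates_in_unit_interval[OF K])
    show "algebraic_int (a * b)" using assms(2) by (auto simp: ring_of_integers_def b)
    fix \<sigma> :: "'k \<Rightarrow> complex" assume \<sigma>: "\<sigma> \<in> embeddings"
    interpret field_hom \<sigma> using embedding_hom \<sigma> .
    obtain s t where st: "\<sigma> a = of_real s" "\<sigma> b = of_real t" "s \<ge> 0" "t \<ge> 0"
      using nonneg \<sigma> unfolding totally_nonnegative_def by (metis Re_complex_of_real Reals_cases)
    have "\<sigma> a + \<sigma> b = 2" by (metis hom_add hom_one one_add_one sum)
    then have "t = 2 - s"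
      using st by (metis add_diff_cancel_left' of_real_add of_real_eq_iff of_real_numeral)
    moreover have "1 - s * (2 - s) = (1 - s)\<^sup>2" by (simp add: power2_eq_square algebra_simps)
    ultimately have "s * t \<le> 1" by (metis diff_ge_0_iff_ge zero_le_power2)
    then show "\<sigma> (a * b) \<in> \<real> \<and> 0 \<le> Re (\<sigma> (a * b)) \<and> Re (\<sigma> (a * b)) \<le> 1"
      using st by (simp add: hom_mult)
  qed
  moreover have "a = 1" if "a * b = 1"
  proof -
    have "(a - 1)\<^sup>2 = 1 - a * b" by (simp add: b power2_eq_square algebra_simps)
    then show ?thesis using that by simp
  qed
  ultimately show ?thesis using b by auto
qed

section \<open>Isometries and diagonal forms\<close>

lemma integers_closed:
  shows "0 \<in> \<O>\<^sub>K" and "1 \<in> \<O>\<^sub>K" and "numeral n \<in> \<O>\<^sub>K"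
    and "x \<in> \<O>\<^sub>K \<Longrightarrow> y \<in> \<O>\<^sub>K \<Longrightarrow> x + y \<in> \<O>\<^sub>K"
    and "x \<in> \<O>\<^sub>K \<Longrightarrow> y \<in> \<O>\<^sub>K \<Longrightarrow> x - y \<in> \<O>\<^sub>K"
    and "x \<in> \<O>\<^sub>K \<Longrightarrow> y \<in> \<O>\<^sub>K \<Longrightarrow> x * y \<in> \<O>\<^sub>K"
    and "x \<in> \<O>\<^sub>K \<Longrightarrow> x ^ k \<in> \<O>\<^sub>K"
    and "(\<And>i. i \<in> A \<Longrightarrow> f i \<in> \<O>\<^sub>K) \<Longrightarrow> sum f A \<in> \<O>\<^sub>K"
  by (auto simp: ring_of_integers_def)

section \<open>Integral matrices and isometry\<close>

lemma integral_vecs_iff: "x \<in> integral_vecs n \<longleftrightarrow> dim_vec x = n \<and> (\<forall>i<n. x $ i \<in> \<O>\<^sub>K)"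
  by (auto simp: integral_vecs_def vec_set_def image_subset_iff)

lemma integral_mats_iff:
  "A \<in> integral_mats n \<longleftrightarrow> A \<in> carrier_mat n n \<and> (\<forall>i<n. \<forall>j<n. A $$ (i, j) \<in> \<O>\<^sub>K)"
  by (auto simp: integral_mats_def elements_mat_def UN_subset_iff image_subset_iff)

lemma integral_mult_mat_vec:
  assumes "A \<in> integral_mats n" and "x \<in> integral_vecs n"
  shows "A *\<^sub>v x \<in> integral_vecs n"
  using assms
  by (auto simp: integral_vecs_iff integral_mats_iff scalar_prod_def intro!: integers_closed)

lemma integral_mult_mat:
  assumes "A \<in> integral_mats n" and "B \<in> integral_mats n"
  shows "A * B \<in> integral_mats n"
  using assms
  by (auto simp: integral_mats_iff scalar_prod_def intro!: integers_closed)

lemma integral_GL_obtain_inverse: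
  assumes "U \<in> integral_GL n"
  obtains V where "U \<in> integral_mats n" and "V \<in> integral_mats n"
    and "U * V = 1\<^sub>m n" and "V * U = 1\<^sub>m n"
  using assms by (auto simp: integral_GL_def inverts_mat_def integral_mats_iff)

lemma integral_GL_I:
  assumes "U \<in> integral_mats n" and "V \<in> integral_mats n"
    and "U * V = 1\<^sub>m n" and "V * U = 1\<^sub>m n"
  shows "U \<in> integral_GL n"
  using assms by (auto simp: integral_GL_def inverts_mat_def integral_mats_iff)

lemma integral_GL_mult:
  assumes "U \<in> integral_GL n" and "U' \<in> integral_GL n"
  shows "U * U' \<in> integral_GL n"
proof -
  obtain V where V: "U \<in> integral_mats n" "V \<in> integral_mats n" "U * V = 1\<^sub>m n" "V * U = 1\<^sub>m n"
    using integral_GL_obtain_inverse assms(1) .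
  obtain V' where V': "U' \<in> integral_mats n" "V' \<in> integral_mats n" "U' * V' = 1\<^sub>m n" "V' * U' = 1\<^sub>m n"
    using integral_GL_obtain_inverse assms(2) .
  have carrier: "U \<in> carrier_mat n n" "V \<in> carrier_mat n n" "U' \<in> carrier_mat n n" "V' \<in> carrier_mat n n"
    using V V' by (auto simp: integral_mats_iff)
  have "(U * U') * (V' * V) = U * ((U' * V') * V)"
    using carrier by (simp add: assoc_mult_mat[of _ n n _ n _ n])
  then have "(U * U') * (V' * V) = 1\<^sub>m n"
    using V V' carrier by simp
  moreover have "(V' * V) * (U * U') = V' * ((V * U) * U')"
    using carrier by (simp add: assoc_mult_mat[of _ n n _ n _ n])
  then have "(V' * V) * (U * U') = 1\<^sub>m n"
    using V V' carrier by simp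
  ultimately show ?thesis
    using V V' by (intro integral_GL_I[of _ _ "V' * V"] integral_mult_mat)
qed

lemma isometric_obtain:
  assumes "Q \<simeq>\<^sub>K R"
  obtains U where "U \<in> integral_GL (dim_row Q)" and "dim_row R = dim_row Q"
    and "\<forall>x\<in>integral_vecs (dim_row Q). form_value R x = form_value Q (U *\<^sub>v x)"
  using assms unfolding isometric_def by metis

lemma isometricI:
  assumes "U \<in> integral_GL (dim_row Q)" and "dim_row R = dim_row Q"
    and "\<And>x. x \<in> integral_vecs (dim_row Q) \<Longrightarrow> form_value R x = form_value Q (U *\<^sub>v x)"
  shows "Q \<simeq>\<^sub>K R"
  unfolding isometric_def using assms(2) by (auto intro!: bexI[OF _ assms(1)] assms(3))

lemma isometric_trans:
  assumes "Q \<simeq>\<^sub>K R" and "R \<simeq>\<^sub>K S"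
  shows "Q \<simeq>\<^sub>K S"
proof -
  let ?n = "dim_row Q"
  obtain U where U: "U \<in> integral_GL ?n" and dim: "dim_row R = ?n"
    and U_val: "\<forall>x\<in>integral_vecs ?n. form_value R x = form_value Q (U *\<^sub>v x)"
    using isometric_obtain[OF assms(1)] .
  obtain U' where U': "U' \<in> integral_GL ?n" and dim': "dim_row S = ?n"
    and U'_val: "\<forall>x\<in>integral_vecs ?n. form_value S x = form_value R (U' *\<^sub>v x)"
    using isometric_obtain[OF assms(2), unfolded dim] .
  have "form_value S x = form_value Q ((U * U') *\<^sub>v x)" if x: "x \<in> integral_vecs ?n" for x
  proof -
    have m: "U \<in> integral_mats ?n" "U' \<in> integral_mats ?n"
      using U U' by (auto simp: integral_GL_def)
    then have "(U * U') *\<^sub>v x = U *\<^sub>v (U' *\<^sub>v x)"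
      using x by (intro assoc_mult_mat_vec) (auto simp: integral_mats_iff integral_vecs_def)
    then show ?thesis
      using U_val U'_val integral_mult_mat_vec[OF m(2) x] x by simp
  qed
  then show ?thesis
    using integral_GL_mult[OF U U'] dim' by (intro isometricI)
qed

text \<open>The substitution by \<open>U\<close> is a bijection of the integral vectors that
  preserves nonzero vectors, with inverse \<open>V\<close>; values on nonzero vectors and
  represented elements therefore carry over.\<close>

lemma universal_form_isometric:
  assumes "universal_form Q" and "Q \<simeq>\<^sub>K R"
  shows "universal_form R"
proof -
  let ?n = "dim_row Q"
  obtain U where U: "U \<in> integral_GL ?n" and dim: "dim_row R = ?n"
    and val: "\<forall>x\<in>integral_vecs ?n. form_value R x = form_value Q (U *\<^sub>v x)"
    using isometric_obtain[OF assms(2)] .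
  obtain V where V: "U \<in> integral_mats ?n" "V \<in> integral_mats ?n" "U * V = 1\<^sub>m ?n" "V * U = 1\<^sub>m ?n"
    using integral_GL_obtain_inverse U .
  have carrier: "U \<in> carrier_mat ?n ?n" "V \<in> carrier_mat ?n ?n"
    using V by (auto simp: integral_mats_iff)
  have UV: "U *\<^sub>v (V *\<^sub>v x) = x" and VU: "V *\<^sub>v (U *\<^sub>v x) = x" if "x \<in> integral_vecs ?n" for x
    using that carrier V(3,4)
    by (auto simp: integral_vecs_def simp flip: assoc_mult_mat_vec[of _ ?n ?n _ ?n])
  have "totally_positive (form_value R x)" if x: "x \<in> integral_vecs ?n" "x \<noteq> 0\<^sub>v ?n" for x
  proof -
    have "U *\<^sub>v x \<noteq> 0\<^sub>v ?n"
    proof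
      assume "U *\<^sub>v x = 0\<^sub>v ?n"
      then have "x = V *\<^sub>v 0\<^sub>v ?n" using VU[OF x(1)] by simp
      also have "\<dots> = 0\<^sub>v ?n" using carrier by (intro eq_vecI) auto
      finally show False using x(2) by simp
    qed
    then show ?thesis
      using assms(1) integral_mult_mat_vec[OF V(1) x(1)] bspec[OF val x(1)]
      by (simp add: universal_form_def positive_definite_form_def)
  qed
  moreover have "represents R a" if a: "a \<in> \<O>\<^sub>K\<^sup>+" for a
  proof -
    obtain x where x: "x \<in> integral_vecs ?n" "form_value Q x = a"
      using assms(1) a by (auto simp: universal_form_def represents_def)
    then have "form_value R (V *\<^sub>v x) = a"
      using bspec[OF val integral_mult_mat_vec[OF V(2) x(1)]] UV[OF x(1)] by simp
    then show ?thesis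
      using integral_mult_mat_vec[OF V(2) x(1)] dim by (auto simp: represents_def)
  qed
  ultimately show ?thesis
    using dim by (simp add: universal_form_def positive_definite_form_def)
qed

section \<open>Values and isometries of diagonal forms\<close>

lemma dim_diag_form [simp]: "dim_row (diag_form as) = length as"
  by (simp add: diag_form_def mat_diag_def)

lemma form_value_diag_form:
  "form_value (diag_form as) x = (\<Sum>i<length as. as ! i * (x $ i)\<^sup>2)"
proof -
  have "(\<Sum>j\<in>{i..<length as}. diag_form as $$ (i, j) * x $ i * x $ j) = as ! i * (x $ i)\<^sup>2"
    if "i < length as" for i
  proof -
    have "(\<Sum>j\<in>{i..<length as}. diag_form as $$ (i, j) * x $ i * x $ j) =
        (\<Sum>j\<in>{i..<length as}. if j = i then as ! i * (x $ i)\<^sup>2 else 0)"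
      using that
      by (intro sum.cong) (auto simp: diag_form_def mat_diag_def power2_eq_square mult.assoc)
    also have "\<dots> = as ! i * (x $ i)\<^sup>2" using that by simp
    finally show ?thesis .
  qed
  then show ?thesis by (simp add: form_value_def)
qed

lemma represents_diag_formI:
  assumes "set xs \<subseteq> \<O>\<^sub>K" and "length xs = length as"
    and "(\<Sum>i<length as. as ! i * (xs ! i)\<^sup>2) = v"
  shows "represents (diag_form as) v"
  unfolding represents_def
proof
  show "vec_of_list xs \<in> integral_vecs (dim_row (diag_form as))"
    using assms(1,2) by (auto simp: integral_vecs_iff vec_of_list_index)
  show "form_value (diag_form as) (vec_of_list xs) = v"
    using assms(3) by (simp add: form_value_diag_form vec_of_list_index)
qed

lemma represents_diag_form_ternary:
  assumes "represents (diag_form [a, b, c]) v"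
  obtains x y z where "x \<in> \<O>\<^sub>K" "y \<in> \<O>\<^sub>K" "z \<in> \<O>\<^sub>K" "v = a * x\<^sup>2 + b * y\<^sup>2 + c * z\<^sup>2"
proof -
  obtain u where "u \<in> integral_vecs 3" "form_value (diag_form [a, b, c]) u = v"
    using assms by (auto simp: represents_def numeral_3_eq_3)
  then show ?thesis
    using that[of "u $ 0" "u $ 1" "u $ 2"]
    by (simp add: form_value_diag_form integral_vecs_iff numeral_3_eq_3 numeral_2_eq_2)
qed

text \<open>The coefficient is the value of the form at a unit vector.\<close>

lemma positive_definite_diag_form:
  fixes as :: "'k::field_char_0 list"
  assumes "positive_definite_form (diag_form as)" and "i < length as"
  shows "totally_positive (as ! i)"
proof -
  let ?n = "length as"
  have "unit_vec ?n i \<in> (integral_vecs ?n :: 'k vec set)"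
    by (auto simp: integral_vecs_iff unit_vec_def intro!: integers_closed)
  moreover have "unit_vec ?n i \<noteq> (0\<^sub>v ?n :: 'k vec)"
    using assms(2) by simp
  moreover have "form_value (diag_form as) (unit_vec ?n i) = (\<Sum>j<?n. if j = i then as ! i else 0)"
    unfolding form_value_diag_form using assms(2) by (intro sum.cong) auto
  then have "form_value (diag_form as) (unit_vec ?n i) = as ! i"
    using assms(2) by simp
  ultimately show ?thesis
    using assms(1) unfolding positive_definite_form_def dim_diag_form by metis
qed

text \<open>Permuting coefficients and multiplying them by squares of units are handled together, as
  one substitution by a monomial matrix. Swaps and normalisation of a coefficient to 1 are
  instances.\<close>

lemma isometric_diag_form_monomial:
  fixes as :: "'k::field_char_0 list"
  assumes len: "length as = n" "length bs = n" and \<pi>: "bij_betw \<pi> {..<n} {..<n}"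
    and unit: "\<And>i. i < n \<Longrightarrow> u i \<in> \<O>\<^sub>K" "\<And>i. i < n \<Longrightarrow> w i \<in> \<O>\<^sub>K" "\<And>i. i < n \<Longrightarrow> u i * w i = 1"
    and bs: "\<And>i. i < n \<Longrightarrow> bs ! \<pi> i = as ! i * (u i)\<^sup>2"
  shows "diag_form as \<simeq>\<^sub>K diag_form bs"
proof -
  \<comment> \<open>\<open>U\<close> takes coordinate \<open>\<pi> i\<close> to position
    \<open>i\<close> and scales it by \<open>u i\<close>; \<open>V\<close> undoes this with the
    inverse units \<open>w i\<close>.\<close>
  define U where "U = mat n n (\<lambda>(i, j). if j = \<pi> i then u i else 0)"
  define V where "V = mat n n (\<lambda>(i, j). if i = \<pi> j then w j else 0)"
  have \<pi>_less: "\<pi> i < n" if "i < n" for i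
    using \<pi> that by (auto simp: bij_betw_def)
  have \<pi>_inj: "\<pi> i = \<pi> j \<longleftrightarrow> i = j" if "i < n" "j < n" for i j
    using \<pi> that by (auto simp: bij_betw_def inj_on_def)
  have carrier: "U \<in> carrier_mat n n" "V \<in> carrier_mat n n"
    by (auto simp: U_def V_def)
  have UV: "U * V = 1\<^sub>m n"
  proof (rule eq_matI)
    fix i k assume ik: "i < dim_row (1\<^sub>m n :: 'k mat)" "k < dim_col (1\<^sub>m n :: 'k mat)"
    then have "(U * V) $$ (i, k) =
        (\<Sum>j<n. (if j = \<pi> i then u i else 0) * (if j = \<pi> k then w k else 0))"
      by (simp add: U_def V_def scalar_prod_def atLeast0LessThan)
    also have "\<dots> = (\<Sum>j<n. if j = \<pi> i then u i * (if \<pi> i = \<pi> k then w k else 0) else 0)"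
      by (intro sum.cong) auto
    also have "\<dots> = (if i = k then 1 else 0)"
      using ik \<pi>_less \<pi>_inj unit(3) by simp
    finally show "(U * V) $$ (i, k) = 1\<^sub>m n $$ (i, k)"
      using ik by simp
  qed (auto simp: U_def V_def)
  moreover have "V * U = 1\<^sub>m n"
    using mat_mult_left_right_inverse[OF carrier UV] .
  moreover have "U \<in> integral_mats n" "V \<in> integral_mats n"
    using unit by (auto simp: integral_mats_iff U_def V_def intro: integers_closed)
  ultimately have "U \<in> integral_GL n"
    by (rule integral_GL_I[rotated 2])
  moreover have "form_value (diag_form bs) x = form_value (diag_form as) (U *\<^sub>v x)"
    if x: "x \<in> integral_vecs n" for x
  proof -
    have "(U *\<^sub>v x) $ i = u i * x $ \<pi> i" if "i < n" for i
    proof -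
      have "(U *\<^sub>v x) $ i = (\<Sum>j<n. (if j = \<pi> i then u i else 0) * x $ j)"
        using that x by (simp add: U_def scalar_prod_def integral_vecs_iff atLeast0LessThan)
      also have "\<dots> = (\<Sum>j<n. if j = \<pi> i then u i * x $ \<pi> i else 0)"
        by (intro sum.cong) auto
      finally show ?thesis using \<pi>_less[OF that] by simp
    qed
    then have "form_value (diag_form as) (U *\<^sub>v x) = (\<Sum>i<n. bs ! \<pi> i * (x $ \<pi> i)\<^sup>2)"
      using len bs by (simp add: form_value_diag_form power_mult_distrib mult.assoc)
    also have "\<dots> = form_value (diag_form bs) x"
      unfolding form_value_diag_form len by (rule sum.reindex_bij_betw[OF \<pi>])
    finally show ?thesis by simp
  qed
  ultimately show ?thesis
    using len by (intro isometricI[of U]) simp_all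
qed

lemma isometric_swap_01: "diag_form [a, b, c] \<simeq>\<^sub>K diag_form [b, a, c]"
proof (rule isometric_diag_form_monomial[where n = 3 and \<pi> = "id(0 := 1, 1 := 0)" and u = "\<lambda>_. 1" and w = "\<lambda>_. 1"])
  show "bij_betw (id(0 := 1, 1 := 0)) {..<3::nat} {..<3}"
    by (auto simp: bij_betw_def inj_on_def image_def numeral_3_eq_3 lessThan_Suc)
  show "[b, a, c] ! (id(0 := 1, 1 := 0)) i = [a, b, c] ! i * 1\<^sup>2" if "i < 3" for i
    using that by (auto simp: numeral_3_eq_3 less_Suc_eq)
qed (auto intro: integers_closed)

lemma isometric_swap_12: "diag_form [a, b, c] \<simeq>\<^sub>K diag_form [a, c, b]"
proof (rule isometric_diag_form_monomial[where n = 3 and \<pi> = "id(1 := 2, 2 := 1)" and u = "\<lambda>_. 1" and w = "\<lambda>_. 1"])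
  show "bij_betw (id(1 := 2, 2 := 1)) {..<3::nat} {..<3}"
    by (auto simp: bij_betw_def inj_on_def image_def numeral_3_eq_3 numeral_2_eq_2 lessThan_Suc)
  show "[a, c, b] ! (id(1 := 2, 2 := 1)) i = [a, b, c] ! i * 1\<^sup>2" if "i < 3" for i
    using that by (auto simp: numeral_3_eq_3 numeral_2_eq_2 less_Suc_eq)
qed (auto intro: integers_closed)

text \<open>The equation shows that \<open>x\<close> is a unit with inverse \<open>a * x\<close>, so
  the first variable can be rescaled by it.\<close>

lemma isometric_scale_to_1:
  assumes "a \<in> \<O>\<^sub>K" and "x \<in> \<O>\<^sub>K" and "a * x\<^sup>2 = 1"
  shows "diag_form [a, b, c] \<simeq>\<^sub>K diag_form [1, b, c]"
proof (rule isometric_diag_form_monomial[where n = 3 and \<pi> = id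
      and u = "\<lambda>i. if i = 0 then x else 1" and w = "\<lambda>i. if i = 0 then a * x else 1"])
  show "[1, b, c] ! id i = [a, b, c] ! i * (if i = 0 then x else 1)\<^sup>2" if "i < 3" for i
    using that assms(3) by (auto simp: numeral_3_eq_3 less_Suc_eq)
  show "(if i = 0 then x else 1) * (if i = 0 then a * x else 1) = 1" for i :: nat
    using assms(3) by (simp add: power2_eq_square ac_simps)
qed (use assms in \<open>auto intro: integers_closed\<close>)

section \<open>Universal diagonal ternary forms\<close>

lemma universal_ternary_coeffs_positive:
  assumes "universal_form Q" and "Q \<simeq>\<^sub>K diag_form [a, b, c]"
  shows "totally_positive a" and "totally_positive b" and "totally_positive c"
proof -
  have "positive_definite_form (diag_form [a, b, c])"
    using universal_form_isometric[OF assms] by (simp add: universal_form_def)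
  from positive_definite_diag_form[OF this, of 0] positive_definite_diag_form[OF this, of 1]
    positive_definite_diag_form[OF this, of 2]
  show "totally_positive a" "totally_positive b" "totally_positive c"
    by simp_all
qed

lemma universal_ternary_represents:
  assumes "universal_form Q" and "Q \<simeq>\<^sub>K diag_form [a, b, c]" and "v \<in> \<O>\<^sub>K\<^sup>+"
  obtains x y z where "x \<in> \<O>\<^sub>K" "y \<in> \<O>\<^sub>K" "z \<in> \<O>\<^sub>K" "v = a * x\<^sup>2 + b * y\<^sup>2 + c * z\<^sup>2"
proof -
  have "represents (diag_form [a, b, c]) v"
    using universal_form_isometric[OF assms(1,2)] assms(3) by (simp add: universal_form_def)
  then show ?thesis
    using represents_diag_form_ternary that by blast
qed

text \<open>In a representation of 1 the three terms are totally nonnegative integers, so one of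
  them is 1 and the others vanish. The coefficient of that term is moved to the front and scaled to
  1.\<close>

lemma universal_ternary_leading_1:
  fixes Q :: "'k::field_char_0 mat"
  assumes real: "totally_real_number_field TYPE('k)"
    and "universal_form Q" and Q: "Q \<simeq>\<^sub>K diag_form [a, b, c]"
    and int: "a \<in> \<O>\<^sub>K" "b \<in> \<O>\<^sub>K" "c \<in> \<O>\<^sub>K"
  obtains b' c' where "b' \<in> \<O>\<^sub>K" "c' \<in> \<O>\<^sub>K" "Q \<simeq>\<^sub>K diag_form [1, b', c']"
proof -
  have K: "number_field TYPE('k)"
    using real by (simp add: totally_real_number_field_def)
  have "1 \<in> (\<O>\<^sub>K\<^sup>+ :: 'k set)"
    by (simp add: totally_positive_integers_def totally_positive_1 integers_closed)
  then obtain x y z where xyz: "x \<in> \<O>\<^sub>K" "y \<in> \<O>\<^sub>K" "z \<in> \<O>\<^sub>K"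
    and sum: "1 = a * x\<^sup>2 + b * y\<^sup>2 + c * z\<^sup>2"
    using universal_ternary_represents[OF assms(2) Q] by blast
  note pos = universal_ternary_coeffs_positive[OF assms(2) Q, THEN totally_nonnegative_if_positive]
  have nonneg: "totally_nonnegative (a * x\<^sup>2)" "totally_nonnegative (b * y\<^sup>2)" "totally_nonnegative (c * z\<^sup>2)"
    using pos totally_nonnegative_mult totally_nonnegative_square[OF real] by blast+
  have "a * x\<^sup>2 \<in> \<O>\<^sub>K" "b * y\<^sup>2 \<in> \<O>\<^sub>K"
    using int xyz by (auto intro: integers_closed)
  then have "a * x\<^sup>2 = 0 \<or> a * x\<^sup>2 = 1"
    using totally_nonnegative_sum_1[OF K _ nonneg(1) totally_nonnegative_add[OF nonneg(2,3)]] sum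
    by (simp add: add.assoc)
  moreover have "b * y\<^sup>2 = 0 \<or> b * y\<^sup>2 = 1" if "a * x\<^sup>2 = 0"
    using totally_nonnegative_sum_1[OF K _ nonneg(2,3)] \<open>b * y\<^sup>2 \<in> \<O>\<^sub>K\<close> sum that by simp
  ultimately consider "a * x\<^sup>2 = 1" | "b * y\<^sup>2 = 1" | "c * z\<^sup>2 = 1"
    using sum by auto
  then show ?thesis
  proof cases
    case 1
    then show ?thesis
      using isometric_trans[OF Q isometric_scale_to_1] int xyz that by blast
  next
    case 2
    then show ?thesis
      using isometric_trans[OF isometric_trans[OF Q isometric_swap_01] isometric_scale_to_1] int xyz that
      by blast
  next
    case 3
    then show ?thesis
      using isometric_trans[OF isometric_trans[OF isometric_trans[OF Q isometric_swap_12] isometric_swap_01]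
          isometric_scale_to_1] int xyz that
      by blast
  qed
qed

text \<open>The cases come from a representation of 2, where \<open>x\<^sup>2\<close> is 0 or 1
  because 2 is not a square. If it is 1, the other two terms add up to 1 and one of them is 1. If it
  is 0, they add up to 2: either both are 1, or one vanishes and the other exhibits 2 as a
  coefficient times a square.\<close>

lemma universal_ternary_normal_form:
  fixes Q :: "'k::field_char_0 mat"
  assumes real: "totally_real_number_field TYPE('k)" and sqrt2: "\<nexists>s::'k. s\<^sup>2 = 2"
    and univ: "universal_form Q" and Q: "Q \<simeq>\<^sub>K diag_form [1, b, c]" and int: "b \<in> \<O>\<^sub>K" "c \<in> \<O>\<^sub>K"
  obtains
    (one) \<alpha> where "\<alpha> \<in> \<O>\<^sub>K" "Q \<simeq>\<^sub>K diag_form [1, 1, \<alpha>]"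
  | (two) \<gamma> \<alpha> t where "\<gamma> \<in> \<O>\<^sub>K" "\<alpha> \<in> \<O>\<^sub>K" "t \<in> \<O>\<^sub>K" "2 = \<gamma> * t\<^sup>2" "Q \<simeq>\<^sub>K diag_form [1, \<gamma>, \<alpha>]"
proof -
  have K: "number_field TYPE('k)"
    using real by (simp add: totally_real_number_field_def)
  have "2 \<in> (\<O>\<^sub>K\<^sup>+ :: 'k set)"
    by (simp add: totally_positive_integers_def totally_positive_2 integers_closed)
  then obtain x y z where xyz: "x \<in> \<O>\<^sub>K" "y \<in> \<O>\<^sub>K" "z \<in> \<O>\<^sub>K"
    and "2 = 1 * x\<^sup>2 + b * y\<^sup>2 + c * z\<^sup>2"
    using universal_ternary_represents[OF univ Q] by blast
  then have sum: "x\<^sup>2 + (b * y\<^sup>2 + c * z\<^sup>2) = 2"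
    by (simp add: add.assoc)
  note pos = universal_ternary_coeffs_positive[OF univ Q, THEN totally_nonnegative_if_positive]
  have nonneg: "totally_nonnegative (x\<^sup>2)" "totally_nonnegative (b * y\<^sup>2)" "totally_nonnegative (c * z\<^sup>2)"
    using pos totally_nonnegative_mult totally_nonnegative_square[OF real] by blast+
  have terms: "x\<^sup>2 \<in> \<O>\<^sub>K" "b * y\<^sup>2 \<in> \<O>\<^sub>K"
    using int xyz by (auto intro: integers_closed)
  have Q': "Q \<simeq>\<^sub>K diag_form [1, c, b]"
    using isometric_trans[OF Q isometric_swap_12] .
  \<comment> \<open>A term equal to 1 makes its coefficient \<open>d\<close> the inverse of a unit
    square. Swapped to the front, \<open>d\<close> is scaled to 1, and the former leading 1 becomes
    the second coefficient.\<close>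
  have unit: thesis if "Q \<simeq>\<^sub>K diag_form [1, d, e]" "d * w\<^sup>2 = 1" "w \<in> \<O>\<^sub>K" "d \<in> \<O>\<^sub>K" "e \<in> \<O>\<^sub>K" for d e w
    using isometric_trans[OF isometric_trans[OF that(1) isometric_swap_01] isometric_scale_to_1] that one
    by blast
  have split: "x\<^sup>2 = 0 \<or> b * y\<^sup>2 + c * z\<^sup>2 = 0 \<or> x\<^sup>2 = 1 \<and> b * y\<^sup>2 + c * z\<^sup>2 = 1"
    using totally_nonnegative_sum_2[OF K terms(1) nonneg(1) totally_nonnegative_add[OF nonneg(2,3)] sum] .
  show ?thesis
  proof (cases "x\<^sup>2 = 0")
    case True
    then have sum': "b * y\<^sup>2 + c * z\<^sup>2 = 2"
      using sum by simp
    then consider "b * y\<^sup>2 = 0" | "c * z\<^sup>2 = 0" | "b * y\<^sup>2 = 1"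
      using totally_nonnegative_sum_2[OF K terms(2) nonneg(2,3)] by blast
    then show ?thesis
    proof cases
      case 1
      then have "2 = c * z\<^sup>2" using sum' by auto
      then show ?thesis using two Q' int xyz by blast
    next
      case 2
      then have "2 = b * y\<^sup>2" using sum' by auto
      then show ?thesis using two Q int xyz by blast
    next
      case 3
      then show ?thesis using unit Q int xyz by blast
    qed
  next
    case False
    have "b * y\<^sup>2 + c * z\<^sup>2 \<noteq> 0"
      using sqrt2 sum by auto
    then have sum': "b * y\<^sup>2 + c * z\<^sup>2 = 1"
      using split False by blast
    then have "b * y\<^sup>2 = 0 \<or> b * y\<^sup>2 = 1"
      using totally_nonnegative_sum_1[OF K terms(2) nonneg(2,3)] by blast
    then have "b * y\<^sup>2 = 1 \<or> c * z\<^sup>2 = 1"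
      using sum' by auto
    then show ?thesis using unit Q Q' int xyz by blast
  qed
qed

text \<open>In a representation of \<open>2 * \<alpha>\<close> the square multiplying \<alpha> is
  totally at most 2, and it is not 2 itself, so it is 0 or 1.\<close>

lemma twice_coeff_sum_two_squares:
  fixes Q :: "'k::field_char_0 mat"
  assumes real: "totally_real_number_field TYPE('k)" and sqrt2: "\<nexists>s::'k. s\<^sup>2 = 2"
    and univ: "universal_form Q" and Q: "Q \<simeq>\<^sub>K diag_form [1, 1, \<alpha>]" and \<alpha>: "\<alpha> \<in> \<O>\<^sub>K"
  obtains x y where "x \<in> \<O>\<^sub>K" "y \<in> \<O>\<^sub>K" "2 * \<alpha> = x\<^sup>2 + y\<^sup>2"
proof -
  have K: "number_field TYPE('k)"
    using real by (simp add: totally_real_number_field_def)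
  note pos = universal_ternary_coeffs_positive(3)[OF univ Q]
  have "2 * \<alpha> \<in> \<O>\<^sub>K\<^sup>+"
    using pos \<alpha> by (simp add: totally_positive_integers_def totally_positive_mult totally_positive_2 integers_closed)
  then obtain x y z where xyz: "x \<in> \<O>\<^sub>K" "y \<in> \<O>\<^sub>K" "z \<in> \<O>\<^sub>K"
    and sum: "2 * \<alpha> = 1 * x\<^sup>2 + 1 * y\<^sup>2 + \<alpha> * z\<^sup>2"
    using universal_ternary_represents[OF univ Q] by blast
  have "\<alpha> * (2 - z\<^sup>2) = x\<^sup>2 + y\<^sup>2"
    using sum by (simp add: algebra_simps)
  then have "totally_nonnegative (\<alpha> * (2 - z\<^sup>2))"
    by (simp add: totally_nonnegative_add totally_nonnegative_square[OF real])
  then have nonneg: "totally_nonnegative (2 - z\<^sup>2)"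
    using totally_nonnegative_cancel[OF pos _ real] by blast
  have "z\<^sup>2 \<in> \<O>\<^sub>K" using xyz by (auto intro: integers_closed)
  from totally_nonnegative_sum_2[OF K this totally_nonnegative_square[OF real] nonneg]
  have "z\<^sup>2 = 0 \<or> z\<^sup>2 = 1"
    using sqrt2 by auto
  then show ?thesis
  proof
    assume "z\<^sup>2 = 0"
    then show ?thesis using sum xyz that by simp
  next
    assume "z\<^sup>2 = 1"
    then have "\<alpha> = x\<^sup>2 + y\<^sup>2" using sum by (simp add: algebra_simps)
    \<comment> \<open>Twice a sum of two squares is again a sum of two squares.\<close>
    then have "2 * \<alpha> = (x + y)\<^sup>2 + (x - y)\<^sup>2"
      by (simp add: power2_eq_square algebra_simps)
    then show ?thesis
      by (rule that[OF integers_closed(4)[OF xyz(1,2)] integers_closed(5)[OF xyz(1,2)]])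
  qed
qed

lemma twice_coeff_square_plus_twice_square:
  fixes Q :: "'k::field_char_0 mat"
  assumes real: "totally_real_number_field TYPE('k)" and sqrt2: "\<nexists>s::'k. s\<^sup>2 = 2"
    and univ: "universal_form Q" and Q: "Q \<simeq>\<^sub>K diag_form [1, \<gamma>, \<alpha>]"
    and int: "\<gamma> \<in> \<O>\<^sub>K" "\<alpha> \<in> \<O>\<^sub>K" "t \<in> \<O>\<^sub>K" and t: "2 = \<gamma> * t\<^sup>2"
  obtains x y where "x \<in> \<O>\<^sub>K" "y \<in> \<O>\<^sub>K" "2 * \<alpha> = x\<^sup>2 + 2 * y\<^sup>2"
proof -
  have K: "number_field TYPE('k)"
    using real by (simp add: totally_real_number_field_def)
  note pos = universal_ternary_coeffs_positive[OF univ Q]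
  have "\<gamma> * \<alpha> \<in> \<O>\<^sub>K\<^sup>+"
    using pos int by (simp add: totally_positive_integers_def totally_positive_mult integers_closed)
  then obtain x y z where xyz: "x \<in> \<O>\<^sub>K" "y \<in> \<O>\<^sub>K" "z \<in> \<O>\<^sub>K"
    and rep: "\<gamma> * \<alpha> = 1 * x\<^sup>2 + \<gamma> * y\<^sup>2 + \<alpha> * z\<^sup>2"
    using universal_ternary_represents[OF univ Q] by blast
  \<comment> \<open>Representing \<open>\<gamma> * \<alpha>\<close> rather than \<open>2 * \<alpha>\<close> makes the multiplication by \<open>t\<^sup>2\<close> produce
    the coefficient 2.\<close>
  have "(\<gamma> * t\<^sup>2) * \<alpha> = (x * t)\<^sup>2 + (\<gamma> * t\<^sup>2) * y\<^sup>2 + \<alpha> * (z * t)\<^sup>2"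
    using arg_cong[OF rep, of "\<lambda>v. v * t\<^sup>2"] by (simp add: power_mult_distrib algebra_simps)
  then have sum: "2 * \<alpha> = (x * t)\<^sup>2 + 2 * y\<^sup>2 + \<alpha> * (z * t)\<^sup>2"
    by (simp flip: t)
  have "\<alpha> * (2 - (z * t)\<^sup>2) = (x * t)\<^sup>2 + 2 * y\<^sup>2"
    using sum by (simp add: algebra_simps)
  then have "totally_nonnegative (\<alpha> * (2 - (z * t)\<^sup>2))"
    by (simp add: totally_nonnegative_add totally_nonnegative_mult totally_nonnegative_square[OF real]
        totally_nonnegative_if_positive[OF totally_positive_2])
  then have nonneg: "totally_nonnegative (2 - (z * t)\<^sup>2)"
    using totally_nonnegative_cancel[OF pos(3) _ real] by blast
  have "(z * t)\<^sup>2 \<in> \<O>\<^sub>K" using xyz int by (auto intro: integers_closed)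
  from totally_nonnegative_sum_2[OF K this totally_nonnegative_square[OF real] nonneg]
  have "(z * t)\<^sup>2 = 0 \<or> (z * t)\<^sup>2 = 1"
    using sqrt2 by auto
  then show ?thesis
  proof
    assume "(z * t)\<^sup>2 = 0"
    then have "2 * \<alpha> = (x * t)\<^sup>2 + 2 * y\<^sup>2" using sum by simp
    then show ?thesis
      by (rule that[OF integers_closed(6)[OF xyz(1) int(3)] xyz(2)])
  next
    assume "(z * t)\<^sup>2 = 1"
    then have "\<alpha> = (x * t)\<^sup>2 + 2 * y\<^sup>2" using sum by simp
    \<comment> \<open>Twice a value of X^2 + 2 Y^2 is again such a value, with the roles of the two
      variables exchanged.\<close>
    then have "2 * \<alpha> = (2 * y)\<^sup>2 + 2 * (x * t)\<^sup>2"
      by (simp add: power2_eq_square algebra_simps)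
    moreover have "2 * y \<in> \<O>\<^sub>K" "x * t \<in> \<O>\<^sub>K"
      using xyz int by (auto intro: integers_closed)
    ultimately show ?thesis using that by blast
  qed
qed

lemma represents_1122:
  assumes "{p, q, r, s} \<subseteq> \<O>\<^sub>K" and "v = p\<^sup>2 + q\<^sup>2 + 2 * r\<^sup>2 + 2 * s\<^sup>2"
  shows "represents (diag_form [1, 1, 2, 2]) v"
  using assms by (intro represents_diag_formI[of "[p, q, r, s]"]) (auto simp: lessThan_Suc)

theorem theorem4p6:
  fixes Q :: "'k::field_char_0 mat"
  assumes "totally_real_number_field TYPE('k)"
    and "\<nexists>s::'k. s\<^sup>2 = 2"
    and "Q \<in> quadratic_forms 3"
    and "classical_form Q"
    and "universal_form Q"
    and "diagonalizable_form Q"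
  shows "(\<forall>\<beta> \<in> (\<O>\<^sub>K\<^sup>+ :: 'k set). represents (diag_form [1, 1, 2, 2]) (2 * \<beta>)) \<and>
    ((\<exists>\<alpha>\<in>\<O>\<^sub>K. Q \<simeq>\<^sub>K diag_form [1, 1, \<alpha>] \<and> (\<exists>x\<in>\<O>\<^sub>K. \<exists>y\<in>\<O>\<^sub>K. 2 * \<alpha> = x\<^sup>2 + y\<^sup>2)) \<or>
     (\<exists>\<gamma>\<in>\<O>\<^sub>K. \<exists>\<alpha>\<in>\<O>\<^sub>K. Q \<simeq>\<^sub>K diag_form [1, \<gamma>, \<alpha>] \<and> (\<exists>t\<in>\<O>\<^sub>K. 2 = \<gamma> * t\<^sup>2) \<and>
        (\<exists>x\<in>\<O>\<^sub>K. \<exists>y\<in>\<O>\<^sub>K. 2 * \<alpha> = x\<^sup>2 + 2 * y\<^sup>2)))"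
proof -
  obtain as where as: "set as \<subseteq> \<O>\<^sub>K" "Q \<simeq>\<^sub>K diag_form as"
    using assms(6) by (auto simp: diagonalizable_form_def)
  then have "length as = 3"
    using assms(3) by (auto simp: isometric_def quadratic_forms_def integral_mats_iff)
  then obtain a b c where abc: "as = [a, b, c]"
    by (auto simp: numeral_3_eq_3 length_Suc_conv)
  then obtain b' c' where "b' \<in> \<O>\<^sub>K" "c' \<in> \<O>\<^sub>K" "Q \<simeq>\<^sub>K diag_form [1, b', c']"
    using universal_ternary_leading_1[OF assms(1,5), of a b c] as by auto
  from assms(1,2,5) this(3,1,2) show ?thesis
  proof (cases rule: universal_ternary_normal_form)
    case (one \<alpha>)
    obtain u v where uv: "u \<in> \<O>\<^sub>K" "v \<in> \<O>\<^sub>K" "2 * \<alpha> = u\<^sup>2 + v\<^sup>2"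
      using twice_coeff_sum_two_squares assms(1,2,5) one(2,1) .
    have "represents (diag_form [1, 1, 2, 2]) (2 * \<beta>)" if \<beta>: "\<beta> \<in> \<O>\<^sub>K\<^sup>+" for \<beta> :: 'k
    proof -
      obtain x y z where xyz: "x \<in> \<O>\<^sub>K" "y \<in> \<O>\<^sub>K" "z \<in> \<O>\<^sub>K" "\<beta> = 1 * x\<^sup>2 + 1 * y\<^sup>2 + \<alpha> * z\<^sup>2"
        using universal_ternary_represents assms(5) one(2) \<beta> .
      \<comment> \<open>Doubling supplies the two coefficients 2, and splitting
        \<open>2 * \<alpha>\<close> into two squares supplies the two coefficients 1.\<close>
      have "2 * \<beta> = 2 * x\<^sup>2 + 2 * y\<^sup>2 + (2 * \<alpha>) * z\<^sup>2"
        using xyz(4) by (simp add: algebra_simps)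
      also have "\<dots> = (u * z)\<^sup>2 + (v * z)\<^sup>2 + 2 * x\<^sup>2 + 2 * y\<^sup>2"
        unfolding uv(3) by (simp add: power_mult_distrib algebra_simps)
      finally show ?thesis
        using uv xyz by (intro represents_1122[of "u * z" "v * z" x y]) (auto intro: integers_closed)
    qed
    then show ?thesis using one uv by blast
  next
    case (two \<gamma> \<alpha> t)
    obtain u v where uv: "u \<in> \<O>\<^sub>K" "v \<in> \<O>\<^sub>K" "2 * \<alpha> = u\<^sup>2 + 2 * v\<^sup>2"
      using twice_coeff_square_plus_twice_square assms(1,2,5) two(5,1-4) .
    have "represents (diag_form [1, 1, 2, 2]) (2 * \<beta>)" if \<beta>: "\<beta> \<in> \<O>\<^sub>K\<^sup>+" for \<beta> :: 'k
    proof -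
      obtain x y z where xyz: "x \<in> \<O>\<^sub>K" "y \<in> \<O>\<^sub>K" "z \<in> \<O>\<^sub>K" "\<beta> = 1 * x\<^sup>2 + \<gamma> * y\<^sup>2 + \<alpha> * z\<^sup>2"
        using universal_ternary_represents assms(5) two(5) \<beta> .
      have "2 * \<beta> = 2 * x\<^sup>2 + 2 * (\<gamma> * y\<^sup>2) + (2 * \<alpha>) * z\<^sup>2"
        using xyz(4) by (simp add: algebra_simps)
      \<comment> \<open>Since \<open>2 = \<gamma> * t\<^sup>2\<close>, twice \<gamma> is the square
        of \<open>\<gamma> * t\<close>: the middle term becomes a plain square, and
        \<open>2 * \<alpha>\<close> contributes one coefficient 1 and one coefficient 2.\<close>
      also have "2 * (\<gamma> * y\<^sup>2) = (\<gamma> * t\<^sup>2) * (\<gamma> * y\<^sup>2)"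
        by (simp flip: two(4))
      also have "\<dots> = (\<gamma> * t * y)\<^sup>2"
        by (simp add: power2_eq_square ac_simps)
      also have "2 * x\<^sup>2 + (\<gamma> * t * y)\<^sup>2 + 2 * \<alpha> * z\<^sup>2 =
          (\<gamma> * t * y)\<^sup>2 + (u * z)\<^sup>2 + 2 * x\<^sup>2 + 2 * (v * z)\<^sup>2"
        unfolding uv(3) by (simp add: power_mult_distrib algebra_simps)
      finally show ?thesis
        using uv xyz two
        by (intro represents_1122[of "\<gamma> * t * y" "u * z" x "v * z"]) (auto intro: integers_closed)
    qed
    then show ?thesis using two uv by blast
  qed
qed

end
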